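(* Let $R$ be an integral domain which is NIP (as a structure in the language of rings) and Noetherian, and suppose $R$ is not a field. Then: (1) The fraction field $\mathrm{Frac}(R)$ has characteristic $0$. (2) $R$ has finitely many maximal ideals $\mathfrak{m}_1,\ldots,\mathfrak{m}_n$. (3) $R$ has Krull dimension $1$, and so $0,\mathfrak{m}_1,\ldots,\mathfrak{m}_n$ are the only prime ideals of $R$.
   Context: Rings are commutative and unital. A ring $R$ is NIP if the first-order theory of the structure $(R,+,\cdot)$ has the non-independence property (NIP). *)

theory Defs
  imports "HOL-Computational_Algebra.Fraction_Field" "HOL-Library.Extended_Nat"
begin

datatype rterm = RVar nat | RAdd rterm rterm | RMul rterm rterm

datatype rform =
    REq rterm rterm
  | RNot rform
  | RAnd rform rform
  | REx nat rform

primrec teval :: "(nat \<Rightarrow> 'a::comm_ring_1) \<Rightarrow> rterm \<Rightarrow> 'a" where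
  "teval e (RVar v) = e v"
| "teval e (RAdd s t) = teval e s + teval e t"
| "teval e (RMul s t) = teval e s * teval e t"

primrec sat :: "(nat \<Rightarrow> 'a::comm_ring_1) \<Rightarrow> rform \<Rightarrow> bool" where
  "sat e (REq s t) = (teval e s = teval e t)"
| "sat e (RNot f) = (\<not> sat e f)"
| "sat e (RAnd f g) = (sat e f \<and> sat e g)"
| "sat e (REx v f) = (\<exists>a. sat (e(v := a)) f)"

text \<open>A partitioned formula phi(x;y): the variables in X are the object variables x,
  all other variables are parameters y. phi has the independence property in the
  ring 'a if for every n there are x-tuples a_0..a_(n-1) and parameter tuples b_S
  (S a subset of {0..n-1}) with phi(a_i, b_S) iff i in S.\<close>

definition has_IP :: "'a::comm_ring_1 itself \<Rightarrow> rform \<Rightarrow> nat set \<Rightarrow> bool" where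
  "has_IP _ \<phi> X \<longleftrightarrow>
     (\<forall>n. \<exists>(a :: nat \<Rightarrow> nat \<Rightarrow> 'a) (b :: nat set \<Rightarrow> nat \<Rightarrow> 'a).
        \<forall>i<n. \<forall>S\<subseteq>{..<n}.
          sat (\<lambda>v. if v \<in> X then a i v else b S v) \<phi> \<longleftrightarrow> i \<in> S)"

text \<open>The ring (R,+,*) is NIP: no partitioned formula has the independence property
  (in R; by compactness this is equivalent to NIP of the complete theory Th(R)).\<close>

definition NIP_ring :: "'a::comm_ring_1 itself \<Rightarrow> bool" where
  "NIP_ring T \<longleftrightarrow> (\<forall>\<phi> X. finite X \<longrightarrow> \<not> has_IP T \<phi> X)"

definition ring_ideal :: "'a::comm_ring_1 set \<Rightarrow> bool" where
  "ring_ideal I \<longleftrightarrow> 0 \<in> I \<and> (\<forall>x\<in>I. \<forall>y\<in>I. x + y \<in> I) \<and> (\<forall>r. \<forall>x\<in>I. r * x \<in> I)"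

definition prime_ideal :: "'a::comm_ring_1 set \<Rightarrow> bool" where
  "prime_ideal P \<longleftrightarrow> ring_ideal P \<and> P \<noteq> UNIV \<and> (\<forall>x y. x * y \<in> P \<longrightarrow> x \<in> P \<or> y \<in> P)"

definition maximal_ideal :: "'a::comm_ring_1 set \<Rightarrow> bool" where
  "maximal_ideal M \<longleftrightarrow> ring_ideal M \<and> M \<noteq> UNIV \<and>
     (\<forall>J. ring_ideal J \<longrightarrow> M \<subseteq> J \<longrightarrow> J = M \<or> J = UNIV)"

definition noetherian :: "'a::comm_ring_1 itself \<Rightarrow> bool" where
  "noetherian _ \<longleftrightarrow> (\<forall>f :: nat \<Rightarrow> 'a set. (\<forall>n. ring_ideal (f n)) \<longrightarrow> mono f \<longrightarrow>
      (\<exists>N. \<forall>n\<ge>N. f n = f N))"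

definition is_field_ring :: "'a::comm_ring_1 itself \<Rightarrow> bool" where
  "is_field_ring _ \<longleftrightarrow> (\<forall>x::'a. x \<noteq> 0 \<longrightarrow> x dvd 1)"

definition krull_dim :: "'a::comm_ring_1 itself \<Rightarrow> enat" where
  "krull_dim _ = Sup {enat n | n. \<exists>P :: nat \<Rightarrow> 'a set.
       (\<forall>i\<le>n. prime_ideal (P i)) \<and> (\<forall>i<n. P i \<subset> P (Suc i))}"

end

theory Submission
  imports Defs "HOL-Computational_Algebra.Polynomial_Factorial"
begin

text \<open>
  In a NIP ring, antichains of primes are finite: by prime avoidance a long antichain makes
  \<open>x dvd y\<close> shatter a large set. For maximal ideals this is the finiteness claim. If a Noetherian
  domain has primes \<open>0 \<subset> P \<subset> M\<close>, then prime avoidance and Krull's principal ideal theorem give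
  infinitely many primes of height one inside \<open>M\<close>, which form an antichain; so the dimension is one.

  In characteristic \<open>p\<close>, the fraction field \<open>K\<close> satisfies \<open>{z ^ p - z | z. z \<in> K} = K\<close>
  (Kaplan--Scanlon--Wagner). This is impossible for a one-dimensional semilocal Noetherian domain:
  extracting \<open>p\<close>-th roots up to units, by solving \<open>y ^ p - y = 1 / w\<close>, yields an infinite chain of
  divisors of some \<open>t\<close> in the ring \<open>B\<close> of almost integral elements of \<open>K\<close>, whereas \<open>B / t B\<close> is a
  Noetherian module by the Krull--Akizuki argument.
\<close>

section \<open>Antichains of primes\<close>

text \<open>Both applications use one object variable and at most two parameters, so
  \<open>X = {0}\<close>; the parameter tuples carry \<open>b S\<close> at coordinate 1 and
  \<open>c S\<close> elsewhere.\<close>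

lemma NIP_not_shattered:
  assumes "NIP_ring TYPE('a::comm_ring_1)"
    and "\<And>e :: nat \<Rightarrow> 'a. sat e \<phi> \<longleftrightarrow> P (e 0) (e 1) (e 2)"
  shows "\<exists>n. \<forall>(a :: nat \<Rightarrow> 'a) b c. \<exists>i<n. \<exists>S\<subseteq>{..<n}. \<not> (P (a i) (b S) (c S) \<longleftrightarrow> i \<in> S)"
proof -
  have "\<not> has_IP TYPE('a) \<phi> {0}"
    using assms(1) unfolding NIP_ring_def by blast
  then have "\<exists>n. \<forall>(a :: nat \<Rightarrow> nat \<Rightarrow> 'a) b. \<exists>i<n. \<exists>S\<subseteq>{..<n}.
      \<not> (sat (\<lambda>v. if v \<in> {0} then a i v else b S v) \<phi> \<longleftrightarrow> i \<in> S)"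
    unfolding has_IP_def by simp
  then obtain n where n: "\<forall>(a :: nat \<Rightarrow> nat \<Rightarrow> 'a) b. \<exists>i<n. \<exists>S\<subseteq>{..<n}.
      \<not> (sat (\<lambda>v. if v \<in> {0} then a i v else b S v) \<phi> \<longleftrightarrow> i \<in> S)" ..
  show ?thesis
  proof (rule exI[of _ n], intro allI)
    fix a :: "nat \<Rightarrow> 'a" and b c :: "nat set \<Rightarrow> 'a"
    show "\<exists>i<n. \<exists>S\<subseteq>{..<n}. \<not> (P (a i) (b S) (c S) \<longleftrightarrow> i \<in> S)"
      using n[rule_format, of "\<lambda>i v. a i" "\<lambda>S v. if v = 1 then b S else c S"] by (simp add: assms(2))
  qed
qed

section \<open>Ideals, Noetherian induction and prime avoidance\<close>

lemma ring_ideal_0: "ring_ideal I \<Longrightarrow> 0 \<in> I"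
  and ring_ideal_add: "ring_ideal I \<Longrightarrow> x \<in> I \<Longrightarrow> y \<in> I \<Longrightarrow> x + y \<in> I"
  and ring_ideal_mult: "ring_ideal I \<Longrightarrow> x \<in> I \<Longrightarrow> r * x \<in> I"
  by (auto simp: ring_ideal_def)

lemma ring_ideal_mult2: "ring_ideal I \<Longrightarrow> x \<in> I \<Longrightarrow> x * r \<in> I"
  by (metis mult.commute ring_ideal_mult)

lemma ring_ideal_uminus: "ring_ideal I \<Longrightarrow> x \<in> I \<Longrightarrow> - x \<in> I"
  using ring_ideal_mult[of I x "- 1"] by simp

lemma ring_ideal_diff: "ring_ideal I \<Longrightarrow> x \<in> I \<Longrightarrow> y \<in> I \<Longrightarrow> x - y \<in> I"
  using ring_ideal_add[of I x "- y"] ring_ideal_uminus[of I y] by simp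

lemma ring_ideal_add_cancel:
  "ring_ideal I \<Longrightarrow> x \<in> I \<Longrightarrow> x + y \<in> I \<longleftrightarrow> y \<in> I"
  by (metis add_diff_cancel_left' ring_ideal_add ring_ideal_diff)

lemma ring_ideal_UNIV_iff: "ring_ideal I \<Longrightarrow> I = UNIV \<longleftrightarrow> 1 \<in> I"
  using ring_ideal_mult[of I 1] by auto

lemma prime_idealD:
  assumes "prime_ideal P"
  shows "ring_ideal P" "P \<noteq> UNIV" "1 \<notin> P" "x * y \<in> P \<longleftrightarrow> x \<in> P \<or> y \<in> P"
  using assms ring_ideal_UNIV_iff[of P] ring_ideal_mult[of P] ring_ideal_mult2[of P]
  by (auto simp: prime_ideal_def)

lemma prime_ideal_prod:
  "finite A \<Longrightarrow> prime_ideal P \<Longrightarrow> (\<Prod>x\<in>A. f x) \<in> P \<longleftrightarrow> (\<exists>x\<in>A. f x \<in> P)"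
  by (induction A rule: finite_induct) (auto simp: prime_idealD)

lemma not_prime_idealE:
  assumes "ring_ideal I" "I \<noteq> UNIV" "\<not> prime_ideal I"
  obtains a b where "a \<notin> I" "b \<notin> I" "a * b \<in> I"
  using assms unfolding prime_ideal_def by blast

definition ideal_insert :: "'a::comm_ring_1 \<Rightarrow> 'a set \<Rightarrow> 'a set" where
  "ideal_insert a I = {x + r * a | x r. x \<in> I}"

lemma ideal_insert:
  assumes "ring_ideal I"
  shows "ring_ideal (ideal_insert a I)" "I \<subseteq> ideal_insert a I" "a \<in> ideal_insert a I"
proof -
  show "I \<subseteq> ideal_insert a I"
    unfolding ideal_insert_def by (force intro: exI[of _ 0])
  show "a \<in> ideal_insert a I"
    unfolding ideal_insert_def using ring_ideal_0[OF assms] by (force intro: exI[of _ 1])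
  show "ring_ideal (ideal_insert a I)"
    unfolding ring_ideal_def
  proof (intro conjI ballI allI)
    show "0 \<in> ideal_insert a I"
      using \<open>I \<subseteq> ideal_insert a I\<close> ring_ideal_0[OF assms] by blast
  next
    fix u v assume "u \<in> ideal_insert a I" "v \<in> ideal_insert a I"
    then obtain x y r s where "x \<in> I" "y \<in> I" "u = x + r * a" "v = y + s * a"
      by (auto simp: ideal_insert_def)
    then have "x + y \<in> I" "u + v = (x + y) + (r + s) * a"
      using assms by (auto simp: ring_ideal_add algebra_simps)
    then show "u + v \<in> ideal_insert a I"
      unfolding ideal_insert_def by blast
  next
    fix t u assume "u \<in> ideal_insert a I"
    then obtain x r where "x \<in> I" "u = x + r * a"
      by (auto simp: ideal_insert_def)
    then have "t * x \<in> I" "t * u = t * x + (t * r) * a"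
      using assms by (auto simp: ring_ideal_mult algebra_simps)
    then show "t * u \<in> ideal_insert a I"
      unfolding ideal_insert_def by blast
  qed
qed

text \<open>An infinite descent along strict reverse inclusion would be an ascending chain of ideals
  that never stops. The induction replaces arguments with finitely many generators.\<close>

lemma noetherian_induct [consumes 2, case_names step]:
  assumes "noetherian TYPE('a::comm_ring_1)" and "ring_ideal I"
    and step: "\<And>I :: 'a set. ring_ideal I \<Longrightarrow>
      (\<And>J. ring_ideal J \<Longrightarrow> I \<subset> J \<Longrightarrow> P J) \<Longrightarrow> P I"
  shows "P I"
proof -
  define r where "r = {(J, I :: 'a set). ring_ideal I \<and> ring_ideal J \<and> I \<subset> J}"
  have "wf r"
    unfolding wf_iff_no_infinite_down_chain
  proof
    assume "\<exists>f. \<forall>i. (f (Suc i), f i) \<in> r"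
    then obtain f where "\<forall>i. (f (Suc i), f i) \<in> r" ..
    then have f: "\<And>i. ring_ideal (f i)" "\<And>i. f i \<subset> f (Suc i)"
      by (simp_all add: r_def)
    then have "mono f"
      by (meson incseq_SucI psubset_imp_subset)
    then obtain N where N: "\<forall>n\<ge>N. f n = f N"
      using assms(1) f(1) unfolding noetherian_def by meson
    have "f (Suc N) = f N"
      using N[rule_format, of "Suc N"] by simp
    with f(2)[of N] show False
      by simp
  qed
  then have "ring_ideal I \<longrightarrow> P I"
  proof (induction I rule: wf_induct_rule)
    case (less I)
    show ?case
    proof
      assume I: "ring_ideal I"
      show "P I"
      proof (rule step[OF I])
        fix J assume "ring_ideal J" "I \<subset> J"
        with I less show "P J"
          by (simp add: r_def)
      qed
    qed
  qed
  then show ?thesis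
    using assms(2) by blast
qed

lemma maximal_ideal_imp_prime:
  assumes "maximal_ideal M"
  shows "prime_ideal M"
proof (rule ccontr)
  have M: "ring_ideal M" "M \<noteq> UNIV"
    using assms by (auto simp: maximal_ideal_def)
  assume "\<not> prime_ideal M"
  then obtain a b where ab: "a \<notin> M" "b \<notin> M" "a * b \<in> M"
    using M by (elim not_prime_idealE)
  have "ideal_insert a M = UNIV"
    using assms ideal_insert[OF M(1), of a] ab(1) unfolding maximal_ideal_def by blast
  then have "1 \<in> ideal_insert a M"
    by blast
  then obtain x r where x: "x \<in> M" "1 = x + r * a"
    by (auto simp: ideal_insert_def)
  have "b = x * b + r * (a * b)"
    using x(2) by (metis distrib_right mult.assoc mult_1)
  then show False
    using ab x(1) M(1) by (metis ring_ideal_add ring_ideal_mult ring_ideal_mult2)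
qed

lemma noetherian_maximal_ideal:
  assumes "noetherian TYPE('a::comm_ring_1)" "ring_ideal (I :: 'a set)" "I \<noteq> UNIV"
  obtains M where "maximal_ideal M" "I \<subseteq> M"
proof -
  have "I \<noteq> UNIV \<longrightarrow> (\<exists>M. maximal_ideal M \<and> I \<subseteq> M)"
    using assms(1,2)
  proof (induction rule: noetherian_induct)
    case (step I)
    then show ?case
      unfolding maximal_ideal_def
      by (smt (verit, best) order.trans order_refl psubsetI psubset_imp_subset)
  qed
  with assms(3) that show thesis by blast
qed

text \<open>Induction on the family: an element that avoids the old members but lies in the new
  prime \<open>Q\<close> is corrected by one that lies in all old members and outside
  \<open>Q\<close>. Incomparability of the primes makes this possible.\<close>

lemma prime_avoidance:
  assumes "finite \<Q>" "\<And>Q. Q \<in> \<Q> \<Longrightarrow> prime_ideal Q"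
    and "\<And>Q Q'. Q \<in> \<Q> \<Longrightarrow> Q' \<in> \<Q> \<Longrightarrow> Q \<subseteq> Q' \<Longrightarrow> Q = Q'"
    and "ring_ideal I" "\<And>Q. Q \<in> \<Q> \<Longrightarrow> \<not> I \<subseteq> Q"
  obtains x where "x \<in> I" "\<And>Q. Q \<in> \<Q> \<Longrightarrow> x \<notin> Q"
proof -
  have "\<exists>x\<in>I. \<forall>Q\<in>\<Q>. x \<notin> Q"
    using assms
  proof (induction \<Q> rule: finite_induct)
    case empty
    then show ?case using ring_ideal_0 by blast
  next
    case (insert Q \<Q>)
    then obtain x where x: "x \<in> I" "\<forall>Q\<in>\<Q>. x \<notin> Q"
      by (metis insertCI)
    show ?case
    proof (cases "x \<in> Q")
      case False
      with x show ?thesis by blast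
    next
      case True
      obtain z where z: "z \<in> I" "z \<notin> Q"
        using insert.prems(4) by blast
      have "\<forall>Q'\<in>\<Q>. \<exists>q. q \<in> Q' \<and> q \<notin> Q"
        using insert.prems(2) insert.hyps(2) by (metis insertCI subsetI)
      then obtain q where q: "\<And>Q'. Q' \<in> \<Q> \<Longrightarrow> q Q' \<in> Q' \<and> q Q' \<notin> Q"
        by metis
      \<comment> \<open>The factor \<open>z\<close> keeps \<open>y\<close> in \<open>I\<close>, each
        \<open>q Q'\<close> puts it into \<open>Q'\<close>, and no factor lies in the prime
        \<open>Q\<close>.\<close>
      define y where "y = z * (\<Prod>Q'\<in>\<Q>. q Q')"
      have "y \<in> Q' \<longleftrightarrow> z \<in> Q' \<or> (\<exists>Q''\<in>\<Q>. q Q'' \<in> Q')" if "Q' \<in> insert Q \<Q>" for Q'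
        using insert.prems(1)[OF that] insert.hyps(1)
        by (simp add: y_def prime_idealD prime_ideal_prod)
      then have y: "y \<notin> Q" "\<forall>Q'\<in>\<Q>. y \<in> Q'"
        using q z by auto
      have "x + y \<in> I"
        using x(1) z(1) insert.prems(3) by (simp add: y_def ring_ideal_add ring_ideal_mult2)
      moreover have "x + y \<notin> Q'" if "Q' \<in> insert Q \<Q>" for Q'
        using that True y x(2) insert.prems(1)[OF that]
        by (metis add.commute insertE prime_idealD(1) ring_ideal_add_cancel)
      ultimately show ?thesis by blast
    qed
  qed
  then show thesis using that by blast
qed

text \<open>Divisibility shatters any system of elements each of which lies in exactly one member of
  the antichain.\<close>

theorem NIP_prime_antichain_finite:
  assumes NIP: "NIP_ring TYPE('a::comm_ring_1)"
    and prime: "\<And>P. P \<in> \<P> \<Longrightarrow> prime_ideal (P :: 'a set)"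
    and antichain: "\<And>P Q. P \<in> \<P> \<Longrightarrow> Q \<in> \<P> \<Longrightarrow> P \<subseteq> Q \<Longrightarrow> P = Q"
  shows "finite \<P>"
proof (rule ccontr)
  assume "infinite \<P>"
  define \<phi> where "\<phi> = REx 3 (REq (RMul (RVar 0) (RVar 3)) (RVar 1))"
  have "sat e \<phi> \<longleftrightarrow> e 0 dvd e 1" for e :: "nat \<Rightarrow> 'a"
    by (auto simp: \<phi>_def dvd_def eq_commute)
  from NIP_not_shattered[where P = "\<lambda>x y z. x dvd y", OF NIP this] obtain n where n:
    "\<forall>(a :: nat \<Rightarrow> 'a) b (c :: nat set \<Rightarrow> 'a). \<exists>i<n. \<exists>S\<subseteq>{..<n}. \<not> (a i dvd b S \<longleftrightarrow> i \<in> S)"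
    ..
  obtain \<Q> where \<Q>: "\<Q> \<subseteq> \<P>" "finite \<Q>" "card \<Q> = n"
    using infinite_arbitrarily_large[OF \<open>infinite \<P>\<close>] by metis
  obtain Q where Q: "bij_betw Q {..<n} \<Q>"
    using ex_bij_betw_nat_finite[OF \<Q>(2)] \<Q>(3) by (auto simp: atLeast0LessThan)
  have Qin: "Q i \<in> \<P>" if "i < n" for i
    using Q \<Q>(1) that by (auto simp: bij_betw_def)
  have Qinj: "Q i = Q j \<Longrightarrow> i = j" if "i < n" "j < n" for i j
    using Q that by (auto simp: bij_betw_def inj_on_def)
  have "\<exists>x\<in>Q i. \<forall>j<n. j \<noteq> i \<longrightarrow> x \<notin> Q j" if i: "i < n" for i
  proof -
    have 1: "finite (Q ` ({..<n} - {i}))"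
      by simp
    have 2: "P \<in> \<P> \<and> P \<noteq> Q i" if "P \<in> Q ` ({..<n} - {i})" for P
      using that Qin Qinj[OF _ i] by auto
    have 3: "\<not> Q i \<subseteq> P" if "P \<in> Q ` ({..<n} - {i})" for P
      using 2[OF that] antichain[OF Qin[OF i], of P] by auto
    obtain x where "x \<in> Q i" "\<And>P. P \<in> Q ` ({..<n} - {i}) \<Longrightarrow> x \<notin> P"
      by (rule prime_avoidance[OF 1 _ _ prime_idealD(1)[OF prime[OF Qin[OF i]]] 3])
        (use 2 prime antichain in \<open>simp_all\<close>)
    then show ?thesis by blast
  qed
  then obtain a where a: "\<And>i. i < n \<Longrightarrow> a i \<in> Q i"
      "\<And>i j. i < n \<Longrightarrow> j < n \<Longrightarrow> j \<noteq> i \<Longrightarrow> a i \<notin> Q j"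
    by metis
  have "a i dvd (\<Prod>j\<in>S. a j) \<longleftrightarrow> i \<in> S" if "i < n" "S \<subseteq> {..<n}" for i S
  proof
    have "finite S"
      using that finite_subset by blast
    show "a i dvd (\<Prod>j\<in>S. a j)" if "i \<in> S"
      using \<open>finite S\<close> that by (rule dvd_prodI)
    \<comment> \<open>Divisibility puts the product, hence some factor \<open>a j\<close>, into the
      prime \<open>Q i\<close>, which forces \<open>j = i\<close>.\<close>
    assume "a i dvd (\<Prod>j\<in>S. a j)"
    moreover have Qi: "prime_ideal (Q i)"
      using prime Qin that by blast
    ultimately have "(\<Prod>j\<in>S. a j) \<in> Q i"
      using a(1)[OF that(1)] by (auto elim!: dvdE simp: prime_idealD)
    then obtain j where "j \<in> S" "a j \<in> Q i"
      using prime_ideal_prod[OF \<open>finite S\<close> Qi] by blast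
    then show "i \<in> S"
      using a(2) that by (metis lessThan_iff subsetD)
  qed
  then have "\<not> (\<exists>i<n. \<exists>S\<subseteq>{..<n}. \<not> (a i dvd (\<Prod>j\<in>S. a j) \<longleftrightarrow> i \<in> S))"
    by simp
  then show False
    using n[rule_format, of a "\<lambda>S. \<Prod>j\<in>S. a j"] by (rule notE)
qed

section \<open>Krull dimension\<close>

definition saturated :: "'a::comm_ring_1 set \<Rightarrow> 'a set \<Rightarrow> bool" where
  "saturated S I \<longleftrightarrow> (\<forall>s\<in>S. \<forall>r. s * r \<in> I \<longrightarrow> r \<in> I)"

text \<open>For a multiplicative \<open>S\<close> and an ideal \<open>I\<close> this is the
  contraction of the extension of \<open>I\<close> to the localization at \<open>S\<close>.
  Saturated ideals thus stand for ideals of the localization, and no ring of fractions is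
  formed.\<close>

definition saturation :: "'a::comm_ring_1 set \<Rightarrow> 'a set \<Rightarrow> 'a set" where
  "saturation S I = {r. \<exists>s\<in>S. s * r \<in> I}"

definition colon :: "'a::comm_ring_1 \<Rightarrow> 'a set \<Rightarrow> 'a set" where
  "colon a I = {r. r * a \<in> I}"

lemma saturatedD: "saturated S I \<Longrightarrow> s \<in> S \<Longrightarrow> s * r \<in> I \<Longrightarrow> r \<in> I"
  by (auto simp: saturated_def)

lemma ring_ideal_colon: "ring_ideal I \<Longrightarrow> ring_ideal (colon a I)"
  by (auto simp: ring_ideal_def colon_def distrib_right mult.assoc)

lemma subset_colon: "ring_ideal I \<Longrightarrow> I \<subseteq> colon a I"
  by (auto simp: colon_def ring_ideal_mult2)

lemma saturated_colon: "saturated S I \<Longrightarrow> saturated S (colon a I)"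
  by (auto simp: saturated_def colon_def mult.assoc)

lemma colon_mono: "I \<subseteq> J \<Longrightarrow> colon a I \<subseteq> colon a J"
  by (auto simp: colon_def)

lemma saturation_mono: "I \<subseteq> J \<Longrightarrow> saturation S I \<subseteq> saturation S J"
  by (auto simp: saturation_def)

lemma ideal_insert_mono: "I \<subseteq> J \<Longrightarrow> ideal_insert a I \<subseteq> ideal_insert a J"
  by (auto simp: ideal_insert_def)

context
  fixes S :: "'a::comm_ring_1 set"
  assumes one_S: "1 \<in> S" and mult_S: "\<And>s t. s \<in> S \<Longrightarrow> t \<in> S \<Longrightarrow> s * t \<in> S"
begin

lemma subset_saturation: "I \<subseteq> saturation S I"
  using one_S by (force simp: saturation_def)

lemma saturated_saturation: "saturated S (saturation S I)"
  unfolding saturated_def saturation_def using mult_S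
  by (auto simp flip: mult.assoc)

lemma ring_ideal_saturation:
  assumes "ring_ideal I"
  shows "ring_ideal (saturation S I)"
  unfolding ring_ideal_def
proof (intro conjI ballI allI)
  show "0 \<in> saturation S I"
    using subset_saturation ring_ideal_0[OF assms] by blast
next
  fix x y assume "x \<in> saturation S I" "y \<in> saturation S I"
  then obtain s t where "s \<in> S" "t \<in> S" "s * x \<in> I" "t * y \<in> I"
    by (auto simp: saturation_def)
  then have "s * t \<in> S" "t * (s * x) + s * (t * y) \<in> I"
    using mult_S assms by (auto simp: ring_ideal_add ring_ideal_mult)
  moreover have "t * (s * x) + s * (t * y) = s * t * (x + y)"
    by (simp add: algebra_simps)
  ultimately show "x + y \<in> saturation S I"
    unfolding saturation_def by auto
next
  fix r x assume "x \<in> saturation S I"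
  then obtain s where "s \<in> S" "s * x \<in> I"
    by (auto simp: saturation_def)
  then show "r * x \<in> saturation S I"
    using ring_ideal_mult[OF assms, of "s * x" r] by (auto simp: saturation_def mult.left_commute)
qed

text \<open>For a non-prime \<open>I\<close> with \<open>a b \<in> I\<close>, an ideal \<open>A \<supseteq> I\<close> in a chain is determined by
  \<open>A + (a)\<close> and \<open>A : a\<close>, which contain the strictly larger ideals \<open>I + (a)\<close> and \<open>I : a\<close>.\<close>

lemma noetherian_saturated_dcc:
  assumes noeth: "noetherian TYPE('a)"
    and max: "\<And>I J. prime_ideal I \<Longrightarrow> saturated S I \<Longrightarrow> x \<in> I \<Longrightarrow>
      ring_ideal J \<Longrightarrow> saturated S J \<Longrightarrow> I \<subseteq> J \<Longrightarrow> J = I \<or> J = UNIV"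
    and A: "\<And>n :: nat. ring_ideal (A n)" "\<And>n. saturated S (A n)" "\<And>n. x \<in> A n" "antimono A"
  shows "\<exists>N. \<forall>n\<ge>N. A n = A N"
proof -
  define good where "good A \<longleftrightarrow> (\<forall>n :: nat. ring_ideal (A n) \<and> saturated S (A n)) \<and> antimono A" for A
  have main: "saturated S I \<longrightarrow> x \<in> I \<longrightarrow>
    (\<forall>A. good A \<longrightarrow> (\<forall>n. I \<subseteq> A n) \<longrightarrow> (\<exists>N. \<forall>n\<ge>N. A n = A N))" if "ring_ideal I" for I
    using noeth that
  proof (induction rule: noetherian_induct)
    case (step I)
    show ?case
    proof (intro impI allI)
      fix A assume I: "saturated S I" "x \<in> I" and goodA: "good A" and IA: "\<forall>n. I \<subseteq> A n"
      have A: "\<And>n. ring_ideal (A n)" "\<And>n. saturated S (A n)" "\<And>m n. m \<le> n \<Longrightarrow> A n \<subseteq> A m"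
        using goodA by (auto simp: good_def antimono_def)
      show "\<exists>N. \<forall>n\<ge>N. A n = A N"
      proof (cases "I = UNIV \<or> prime_ideal I")
        case True
        \<comment> \<open>Above a prime \<open>I\<close> containing \<open>x\<close> only
          \<open>I\<close> and the whole ring are available, so the descending chain changes at most
          once.\<close>
        then have "A n = I \<or> A n = UNIV" for n
          using max[of I "A n"] I A(1,2) IA by blast
        then show ?thesis
          using A(3) IA by (metis subset_antisym)
      next
        case False
        then obtain a b where ab: "a \<notin> I" "b \<notin> I" "a * b \<in> I"
          using not_prime_idealE[OF step.hyps] by blast
        define B where "B n = saturation S (ideal_insert a (A n))" for n
        define C where "C n = colon a (A n)" for n
        have "I \<subset> saturation S (ideal_insert a I)"
          using ideal_insert[OF step.hyps, of a] subset_saturation[of "ideal_insert a I"] ab(1) by blast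
        moreover have "good B"
          unfolding good_def B_def using A
          by (auto simp: ring_ideal_saturation ideal_insert saturated_saturation intro!: antimonoI)
            (metis ideal_insert_mono saturation_mono subsetD)
        moreover have "saturation S (ideal_insert a I) \<subseteq> B n" for n
          unfolding B_def using IA by (simp add: saturation_mono ideal_insert_mono)
        moreover have "ring_ideal (saturation S (ideal_insert a I))"
          using step.hyps by (simp add: ring_ideal_saturation ideal_insert)
        ultimately obtain N1 where N1: "\<forall>n\<ge>N1. B n = B N1"
          using step.IH[of "saturation S (ideal_insert a I)"] I(2) saturated_saturation by blast
        have "b \<in> colon a I"
          using ab(3) by (simp add: colon_def mult.commute)
        then have "I \<subset> colon a I"
          using subset_colon[OF step.hyps] ab(2) by blast
        moreover have "good C"
          unfolding good_def C_def using A
          by (auto simp: ring_ideal_colon saturated_colon intro!: antimonoI)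
            (metis colon_mono subsetD)
        moreover have "colon a I \<subseteq> C n" for n
          unfolding C_def colon_def using IA by auto
        ultimately obtain N2 where N2: "\<forall>n\<ge>N2. C n = C N2"
          using step.IH[of "colon a I"] I saturated_colon ring_ideal_colon[OF step.hyps] by blast
        define N where "N = max N1 N2"
        \<comment> \<open>Once \<open>B\<close> and \<open>C\<close> are constant, write
          \<open>s * r = q + c * a\<close> with \<open>q\<close> in \<open>A n\<close>. Then
          \<open>c\<close> lies in \<open>C N = C n\<close>, so \<open>s * r\<close>, and by
          saturation \<open>r\<close>, lies in \<open>A n\<close>.\<close>
        have "A N \<subseteq> A n" if "n \<ge> N" for n
        proof
          fix r assume r: "r \<in> A N"
          have "B n = B N1" "B N = B N1" "C n = C N2" "C N = C N2"
            using that by (intro N1[rule_format] N2[rule_format]; simp add: N_def)+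
          then have "B N = B n" "C N = C n"
            by (simp_all only:)
          have "r \<in> B n"
            using r \<open>B N = B n\<close> ideal_insert(2)[OF A(1), of N a] subset_saturation
            unfolding B_def by blast
          then obtain s q c where s: "s \<in> S" "q \<in> A n" "s * r = q + c * a"
            by (auto simp: B_def saturation_def ideal_insert_def)
          have "q \<in> A N" "s * r \<in> A N"
            using s(2) A(3)[OF that] r A(1) by (auto simp: ring_ideal_mult)
          then have "c * a \<in> A N"
            using s(3) A(1) by (metis ring_ideal_add_cancel)
          then have "c * a \<in> A n"
            using \<open>C N = C n\<close> by (auto simp: C_def colon_def)
          then have "s * r \<in> A n"
            using s A(1) by (simp add: ring_ideal_add)
          then show "r \<in> A n"
            using s(1) A(2) saturatedD by blast
        qed
        then show ?thesis
          using A(3) by (metis subset_antisym)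
      qed
    qed
  qed
  \<comment> \<open>The intersection of the chain is the lower bound to which the induction is
    applied.\<close>
  have "ring_ideal (\<Inter>n. A n)"
    unfolding ring_ideal_def[of "\<Inter>n. A n"]
    using A(1) by (simp add: ring_ideal_0 ring_ideal_add ring_ideal_mult)
  moreover have "saturated S (\<Inter>n. A n)"
    unfolding saturated_def[of S "\<Inter>n. A n"] using saturatedD[OF A(2)] by blast
  moreover have "x \<in> (\<Inter>n. A n)" "\<forall>n. (\<Inter>n. A n) \<subseteq> A n"
    using A(3) by auto
  moreover have "good A"
    using A by (simp add: good_def)
  ultimately show ?thesis
    using main[of "\<Inter>n. A n"] by simp
qed

end

text \<open>Noetherian induction yields finitely many primes over \<open>I\<close> such that every
  prime over \<open>I\<close> contains one of them: if \<open>a * b\<close> is in \<open>I\<close>,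
  each prime over \<open>I\<close> contains \<open>I\<close> + (\<open>a\<close>) or
  \<open>I\<close> + (\<open>b\<close>). For the ideal (\<open>x\<close>), a minimal one among those
  inside \<open>Q\<close> is the required prime.\<close>

lemma noetherian_minimal_prime:
  assumes noeth: "noetherian TYPE('a::comm_ring_1)" and Q: "prime_ideal Q" "(x :: 'a) \<in> Q"
  obtains P where "prime_ideal P" "x \<in> P" "P \<subseteq> Q"
    "\<And>P'. prime_ideal P' \<Longrightarrow> x \<in> P' \<Longrightarrow> P' \<subseteq> P \<Longrightarrow> P' = P"
proof -
  have *: "\<exists>\<F>. finite \<F> \<and> (\<forall>P\<in>\<F>. prime_ideal P \<and> I \<subseteq> P) \<and>
      (\<forall>Q. prime_ideal Q \<longrightarrow> I \<subseteq> Q \<longrightarrow> (\<exists>P\<in>\<F>. P \<subseteq> Q))" if "ring_ideal I" for I :: "'a set"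
    using noeth that
  proof (induction rule: noetherian_induct)
    case (step I)
    consider "I = UNIV" | "prime_ideal I" | "I \<noteq> UNIV" "\<not> prime_ideal I" by blast
    then show ?case
    proof cases
      case 1
      then show ?thesis by (intro exI[of _ "{}"]) (auto simp: prime_ideal_def)
    next
      case 2
      then show ?thesis by (intro exI[of _ "{I}"]) auto
    next
      case 3
      then obtain a b where ab: "a \<notin> I" "b \<notin> I" "a * b \<in> I"
        using not_prime_idealE[OF step.hyps] by blast
      have ins: "ring_ideal (ideal_insert c I)" "I \<subseteq> ideal_insert c I" "c \<in> ideal_insert c I" for c
        using ideal_insert[OF step.hyps] by auto
      obtain \<F> where \<F>: "finite \<F>" "\<forall>P\<in>\<F>. prime_ideal P \<and> ideal_insert a I \<subseteq> P"
        "\<forall>Q. prime_ideal Q \<longrightarrow> ideal_insert a I \<subseteq> Q \<longrightarrow> (\<exists>P\<in>\<F>. P \<subseteq> Q)"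
        using step.IH[OF ins(1), of a] ins[of a] ab(1) by blast
      obtain \<G> where \<G>: "finite \<G>" "\<forall>P\<in>\<G>. prime_ideal P \<and> ideal_insert b I \<subseteq> P"
        "\<forall>Q. prime_ideal Q \<longrightarrow> ideal_insert b I \<subseteq> Q \<longrightarrow> (\<exists>P\<in>\<G>. P \<subseteq> Q)"
        using step.IH[OF ins(1), of b] ins[of b] ab(2) by blast
      have least: "ideal_insert c I \<subseteq> Q" if "prime_ideal Q" "I \<subseteq> Q" "c \<in> Q" for c Q
        using that by (auto simp: ideal_insert_def intro!: ring_ideal_add ring_ideal_mult prime_idealD)
      have "\<exists>P\<in>\<F> \<union> \<G>. P \<subseteq> Q" if Q: "prime_ideal Q" "I \<subseteq> Q" for Q
      proof -
        have "a \<in> Q \<or> b \<in> Q"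
          using ab(3) Q prime_idealD(4) by blast
        then show ?thesis
        proof
          assume "a \<in> Q"
          with Q(1) least[OF Q] \<F>(3) show ?thesis by (meson UnI1)
        next
          assume "b \<in> Q"
          with Q(1) least[OF Q] \<G>(3) show ?thesis by (meson UnI2)
        qed
      qed
      moreover have "\<forall>P\<in>\<F> \<union> \<G>. prime_ideal P \<and> I \<subseteq> P"
        using \<F>(2) \<G>(2) ins(2) by blast
      ultimately show ?thesis
        using \<F>(1) \<G>(1) by (intro exI[of _ "\<F> \<union> \<G>"]) auto
    qed
  qed
  define I where "I = ideal_insert x {0}"
  have I: "ring_ideal I" "x \<in> I"
    using ideal_insert[of "{0}" x] by (auto simp: I_def ring_ideal_def)
  have I_sub: "I \<subseteq> P" if "prime_ideal P" "x \<in> P" for P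
    using that by (auto simp: I_def ideal_insert_def ring_ideal_mult prime_idealD)
  obtain \<F> where \<F>: "finite \<F>" "\<forall>P\<in>\<F>. prime_ideal P \<and> I \<subseteq> P"
      "\<forall>Q. prime_ideal Q \<longrightarrow> I \<subseteq> Q \<longrightarrow> (\<exists>P\<in>\<F>. P \<subseteq> Q)"
    using *[OF I(1)] by blast
  have "{P \<in> \<F>. P \<subseteq> Q} \<noteq> {}"
    using \<F>(3) I_sub[OF Q] Q(1) by blast
  moreover have "finite {P \<in> \<F>. P \<subseteq> Q}"
    using \<F>(1) by simp
  ultimately have "\<exists>P\<in>{P \<in> \<F>. P \<subseteq> Q}. \<forall>P'\<in>{P \<in> \<F>. P \<subseteq> Q}. P' \<subseteq> P \<longrightarrow> P = P'"
    by (rule finite_has_minimal[rotated])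
  then obtain P where P: "P \<in> {P \<in> \<F>. P \<subseteq> Q}" "\<forall>P'\<in>{P \<in> \<F>. P \<subseteq> Q}. P' \<subseteq> P \<longrightarrow> P = P'"
    ..
  then have P: "P \<in> \<F>" "P \<subseteq> Q" "\<And>P'. P' \<in> \<F> \<Longrightarrow> P' \<subseteq> Q \<Longrightarrow> P' \<subseteq> P \<Longrightarrow> P' = P"
    by auto
  show thesis
  proof (rule that)
    show "prime_ideal P" "x \<in> P" "P \<subseteq> Q"
      using P \<F>(2) I(2) by auto
  next
    fix P' assume P': "prime_ideal P'" "x \<in> P'" "P' \<subseteq> P"
    then obtain P'' where "P'' \<in> \<F>" "P'' \<subseteq> P'"
      using \<F>(3) I_sub by blast
    then show "P' = P"
      using P P' by blast
  qed
qed

text \<open>For \<open>0 \<noteq> y \<in> Q\<close>, the ideals \<open>J n\<close> are \<open>(y ^ n)\<close> localized at \<open>Q\<close> and contracted. Together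
  with \<open>x\<close> they form a chain which becomes stationary, and a Nakayama-type argument then gives
  \<open>y ^ N \<in> J (N + 1)\<close>.\<close>

theorem krull_principal_ideal:
  assumes noeth: "noetherian TYPE('a::idom)"
    and P: "prime_ideal P" "(x :: 'a) \<in> P"
    and minimal: "\<And>P'. prime_ideal P' \<Longrightarrow> x \<in> P' \<Longrightarrow> P' \<subseteq> P \<Longrightarrow> P' = P"
    and Q: "prime_ideal Q" "Q \<subset> P"
  shows "Q = {0}"
proof (rule ccontr)
  assume "Q \<noteq> {0}"
  then obtain y where y: "y \<in> Q" "y \<noteq> 0"
    using ring_ideal_0[OF prime_idealD(1)[OF Q(1)]] by blast
  have x: "x \<notin> Q"
    using minimal Q by blast
  have S: "1 \<in> - P" "\<And>s t. s \<in> - P \<Longrightarrow> t \<in> - P \<Longrightarrow> s * t \<in> - P"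
    if "prime_ideal P" for P :: "'a set"
    using that by (auto simp: prime_idealD)
  define J where "J n = saturation (- Q) {r. y ^ n dvd r}" for n
  have J_ideal: "ring_ideal (J n)" for n
    unfolding J_def
    by (rule ring_ideal_saturation[OF S[OF Q(1)]]) (auto simp: ring_ideal_def)
  have J_sat: "saturated (- Q) (J n)" for n
    unfolding J_def by (rule saturated_saturation[OF S[OF Q(1)]])
  have J_sat': "r \<in> J n" if "s \<notin> P" "s * r \<in> J n" for s r n
    using that Q(2) saturatedD[OF J_sat, of s] by blast
  have J_antimono: "J n \<subseteq> J m" if "m \<le> n" for m n
    unfolding J_def using le_imp_power_dvd[OF that, of y]
    by (intro saturation_mono) (auto intro: dvd_trans)
  note S = S[OF P(1)]
  define A where "A n = saturation (- P) (ideal_insert x (J n))" for n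
  have "\<exists>N. \<forall>n\<ge>N. A n = A N"
  proof (rule noetherian_saturated_dcc[OF S noeth])
    fix I J
    assume I: "prime_ideal I" "saturated (- P) I" "x \<in> I"
      and J: "ring_ideal J" "saturated (- P) J" "I \<subseteq> J"
    \<comment> \<open>Modulo \<open>x\<close> the localization at \<open>P\<close> has dimension
      zero: a saturated ideal with an element outside \<open>P\<close> contains 1, and by minimality
      \<open>P\<close> is the only saturated prime containing \<open>x\<close>.\<close>
    have proper: "K \<subseteq> P" if "ring_ideal K" "saturated (- P) K" "K \<noteq> UNIV" for K
      using that saturatedD[of "- P" K _ 1] ring_ideal_UNIV_iff[of K] by fastforce
    have "I = P"
      using I minimal proper[of I] by (auto simp: prime_idealD)
    then show "J = I \<or> J = UNIV"
      using J proper[of J] by blast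
  next
    show "antimono A"
      unfolding A_def using J_antimono
      by (intro antimonoI saturation_mono ideal_insert_mono)
  next
    fix n
    show "ring_ideal (A n)"
      unfolding A_def by (intro ring_ideal_saturation[OF S] ideal_insert(1) J_ideal)
    show "saturated (- P) (A n)"
      unfolding A_def by (rule saturated_saturation[OF S])
    show "x \<in> A n"
      unfolding A_def using ideal_insert(3)[OF J_ideal] subset_saturation[OF S] by blast
  qed
  then obtain N where N: "A (Suc N) = A N"
    by (meson le_Suc_eq order_refl)
  \<comment> \<open>Up to factors outside \<open>P\<close>, \<open>J N\<close> lies in
    \<open>J (Suc N)\<close> + \<open>x\<close> \<open>J N\<close>. The coefficient of
    \<open>x\<close> is in \<open>J N\<close> because \<open>x\<close> is outside \<open>Q\<close>
    and \<open>J N\<close> is saturated with respect to such elements.\<close>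
  have reduce: "\<exists>s a'. s \<notin> P \<and> a' \<in> J N \<and> s * a - a' * x \<in> J (Suc N)" if "a \<in> J N" for a
  proof -
    have "a \<in> A (Suc N)"
      unfolding N unfolding A_def
      using that ideal_insert(2)[OF J_ideal] subset_saturation[OF S] by blast
    then obtain s q c where s: "s \<notin> P" "q \<in> J (Suc N)" "s * a = q + c * x"
      by (auto simp: A_def saturation_def ideal_insert_def)
    have "q \<in> J N"
      using s(2) J_antimono[of N "Suc N"] by auto
    then have "x * c \<in> J N"
      using s(3) that J_ideal by (metis mult.commute ring_ideal_add_cancel ring_ideal_mult)
    then have "c \<in> J N"
      using x saturatedD[OF J_sat] by blast
    then show ?thesis
      using s by (intro exI[of _ s] exI[of _ c]) simp
  qed
  \<comment> \<open>Noetherian induction on \<open>C a\<close> takes the place of Nakayama's lemma.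
    Passing from \<open>a\<close> to the \<open>b\<close> given by \<open>reduce\<close> enlarges
    \<open>C a\<close>; if it does not grow, \<open>b\<close> is a multiple of \<open>x * b\<close>
    modulo \<open>J (Suc N)\<close>, up to factors outside \<open>P\<close>.\<close>
  define C where "C a = saturation (- P) (ideal_insert a (J (Suc N)))" for a
  have C_ideal: "ring_ideal (C a)" for a
    unfolding C_def by (intro ring_ideal_saturation[OF S] ideal_insert(1) J_ideal)
  have "\<forall>a\<in>J N. I = C a \<longrightarrow> a \<in> J (Suc N)" if "ring_ideal I" for I
    using noeth that
  proof (induction rule: noetherian_induct)
    case (step I)
    show ?case
    proof (intro ballI impI)
      fix a assume a: "a \<in> J N" "I = C a"
      obtain s b where s: "s \<notin> P" and b: "b \<in> J N" and sb: "s * a - b * x \<in> J (Suc N)"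
        using reduce[OF a(1)] by blast
      have sa: "s * a = (s * a - b * x) + x * b"
        by (simp add: mult.commute)
      have "C a \<subseteq> C b"
      proof
        fix r assume "r \<in> C a"
        then obtain t q c where t: "t \<in> - P" "q \<in> J (Suc N)" "t * r = q + c * a"
          by (auto simp: C_def saturation_def ideal_insert_def)
        have "(s * t) * r = (s * q + c * (s * a - b * x)) + (c * x) * b"
          by (simp add: mult.assoc t(3)) (simp add: algebra_simps)
        moreover have "s * q + c * (s * a - b * x) \<in> J (Suc N)"
          using t(2) sb J_ideal by (simp add: ring_ideal_add ring_ideal_mult)
        moreover have "s * t \<in> - P"
          using S(2) s t(1) by blast
        ultimately show "r \<in> C b"
          unfolding C_def saturation_def ideal_insert_def by blast
      qed
      have "b \<in> J (Suc N)"
      proof (cases "C a = C b")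
        case False
        then show ?thesis
          using step.IH[OF C_ideal, of b] \<open>C a \<subseteq> C b\<close> a(2) b by blast
      next
        case True
        have "b \<in> C b"
          unfolding C_def using ideal_insert(3)[OF J_ideal] subset_saturation[OF S] by blast
        then obtain t q c where t: "t \<notin> P" "q \<in> J (Suc N)" "t * b = q + c * a"
          unfolding True[symmetric] by (auto simp: C_def saturation_def ideal_insert_def)
        have "(s * t - c * x) * b = s * (t * b) - c * x * b"
          by (simp add: algebra_simps)
        also have "\<dots> = s * q + c * (s * a - b * x)"
          unfolding t(3) by (simp add: algebra_simps)
        also have "\<dots> \<in> J (Suc N)"
          using t(2) sb J_ideal by (simp add: ring_ideal_add ring_ideal_mult)
        finally have "(s * t - c * x) * b \<in> J (Suc N)" .
        moreover have "s * t \<notin> P"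
          using s t(1) P(1) by (simp add: prime_idealD)
        \<comment> \<open>An element outside \<open>P\<close> minus a multiple of \<open>x\<close>
          stays outside \<open>P\<close> and can be cancelled by saturation.\<close>
        then have "s * t - c * x \<notin> P"
          using P ring_ideal_mult[of P x c] ring_ideal_add[of P "s * t - c * x" "c * x"]
          by (auto simp: prime_idealD)
        ultimately show ?thesis
          using J_sat' by blast
      qed
      then have "s * a \<in> J (Suc N)"
        using sa sb J_ideal by (metis ring_ideal_add ring_ideal_mult)
      then show "a \<in> J (Suc N)"
        using s J_sat' by blast
    qed
  qed
  then have "J N \<subseteq> J (Suc N)"
    using C_ideal by blast
  moreover have "y ^ N \<in> J N"
    unfolding J_def saturation_def using prime_idealD(3)[OF Q(1)] by force
  ultimately have "y ^ N \<in> J (Suc N)"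
    by blast
  then obtain s where "s \<notin> Q" "y ^ Suc N dvd s * y ^ N"
    by (auto simp only: J_def saturation_def mem_Collect_eq Compl_iff)
  then obtain t where "s * y ^ N = y ^ Suc N * t"
    by (elim dvdE)
  then have "s = y * t"
    using y(2) by simp
  then show False
    using y(1) Q(1) \<open>s \<notin> Q\<close> by (simp add: prime_idealD)
qed

text \<open>Below a maximal \<open>M\<close> strictly above \<open>P\<close>, Krull's theorem puts
  each nonzero element into a prime of height one. These primes are finitely many by NIP and none
  contains \<open>M\<close>, so prime avoidance gives an element of \<open>M\<close> outside all of
  them.\<close>

theorem NIP_noetherian_prime_maximal:
  assumes NIP: "NIP_ring TYPE('a::idom)" and noeth: "noetherian TYPE('a)"
    and P: "prime_ideal P" "P \<noteq> {0 :: 'a}"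
  shows "maximal_ideal P"
proof (rule ccontr)
  assume "\<not> maximal_ideal P"
  then obtain K where K: "ring_ideal K" "P \<subset> K" "K \<noteq> UNIV"
    using P(1) by (auto simp: maximal_ideal_def prime_ideal_def)
  then obtain M where "maximal_ideal M" "K \<subseteq> M"
    using noetherian_maximal_ideal[OF noeth] by metis
  then have M: "prime_ideal M" "P \<subset> M"
    using maximal_ideal_imp_prime K(2) by auto
  define \<H> where "\<H> = {H. prime_ideal H \<and> H \<noteq> {0} \<and> H \<subseteq> M \<and> (\<forall>Q. prime_ideal Q \<longrightarrow> Q \<subset> H \<longrightarrow> Q = {0})}"
  have height_one: "\<exists>H\<in>\<H>. z \<in> H" if z: "z \<in> M" "z \<noteq> 0" for z
  proof -
    obtain H where H: "prime_ideal H" "z \<in> H" "H \<subseteq> M"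
      "\<And>P'. prime_ideal P' \<Longrightarrow> z \<in> P' \<Longrightarrow> P' \<subseteq> H \<Longrightarrow> P' = H"
      using noetherian_minimal_prime[OF noeth M(1) z(1)] by metis
    then have "H \<in> \<H>"
      using z(2) krull_principal_ideal[OF noeth H(1,2,4)] by (auto simp: \<H>_def)
    with H(2) show ?thesis by blast
  qed
  have "finite \<H>"
    by (rule NIP_prime_antichain_finite[OF NIP]) (auto simp: \<H>_def)
  \<comment> \<open>Otherwise \<open>H = M\<close>, but \<open>P\<close> is a nonzero prime strictly
    inside \<open>M\<close>.\<close>
  moreover have "\<not> M \<subseteq> H" if "H \<in> \<H>" for H
    using that M P by (auto simp: \<H>_def)
  moreover have "prime_ideal H" "\<And>H'. H' \<in> \<H> \<Longrightarrow> H \<subseteq> H' \<Longrightarrow> H = H'" if "H \<in> \<H>" for H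
    using that by (auto simp: \<H>_def)
  ultimately obtain x where x: "x \<in> M" "\<And>H. H \<in> \<H> \<Longrightarrow> x \<notin> H"
    using prime_avoidance[of \<H> M] prime_idealD(1)[OF M(1)] by metis
  obtain z where "z \<in> M" "z \<noteq> 0"
    using P M ring_ideal_0[OF prime_idealD(1)[OF P(1)]] by blast
  then obtain H where "H \<in> \<H>"
    using height_one by blast
  then have "x \<noteq> 0"
    using x(2)[of H] ring_ideal_0[of H] by (auto simp: \<H>_def prime_idealD)
  then show False
    using height_one x by blast
qed

section \<open>Artin--Schreier elements of the fraction field\<close>

lemma power_prime_add:
  fixes x y :: "'b::comm_ring_1"
  assumes "prime p" "of_nat p = (0 :: 'b)"
  shows "(x + y) ^ p = x ^ p + y ^ p"
proof -
  have "p > 0"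
    using assms(1) prime_gt_0_nat by blast
  have "(x + y) ^ p = (\<Sum>k\<in>{0, p}. of_nat (p choose k) * x ^ k * y ^ (p - k))"
    unfolding binomial_ring
  proof (rule sum.mono_neutral_right)
    show "\<forall>k\<in>{..p} - {0, p}. of_nat (p choose k) * x ^ k * y ^ (p - k) = 0"
    proof
      fix k assume "k \<in> {..p} - {0, p}"
      then have "p dvd (p choose k)"
        using assms(1) \<open>p > 0\<close> by (intro dvd_choose_prime) auto
      then have "of_nat (p choose k) = (0 :: 'b)"
        using assms(2) by (auto elim!: dvdE)
      then show "of_nat (p choose k) * x ^ k * y ^ (p - k) = 0"
        by simp
    qed
  qed auto
  then show ?thesis
    using \<open>p > 0\<close> by (simp add: add.commute)
qed

lemma power_prime_diff:
  fixes x y :: "'b::comm_ring_1"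
  assumes "prime p" "of_nat p = (0 :: 'b)"
  shows "(x - y) ^ p = x ^ p - y ^ p"
  using power_prime_add[OF assms, of "x - y" y] by simp

definition artin_schreier :: "nat \<Rightarrow> 'b::comm_ring_1 set" where
  "artin_schreier p = range (\<lambda>z. z ^ p - z)"

context
  fixes p :: nat
  assumes p: "prime p" "of_nat p = (0 :: 'b::comm_ring_1)"
begin

lemma artin_schreier_add:
  assumes "x \<in> artin_schreier p" "y \<in> artin_schreier p"
  shows "x + y \<in> (artin_schreier p :: 'b set)"
proof -
  obtain v w where "x = v ^ p - v" "y = w ^ p - w"
    using assms by (auto simp: artin_schreier_def)
  then have "x + y = (v + w) ^ p - (v + w)"
    by (simp add: power_prime_add[OF p])
  then show ?thesis
    by (simp add: artin_schreier_def)
qed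

lemma artin_schreier_diff:
  assumes "x \<in> artin_schreier p" "y \<in> artin_schreier p"
  shows "x - y \<in> (artin_schreier p :: 'b set)"
proof -
  obtain v w where "x = v ^ p - v" "y = w ^ p - w"
    using assms by (auto simp: artin_schreier_def)
  then have "x - y = (v - w) ^ p - (v - w)"
    by (simp add: power_prime_diff[OF p])
  then show ?thesis
    by (simp add: artin_schreier_def)
qed

lemma artin_schreier_0: "0 \<in> (artin_schreier p :: 'b set)"
  using prime_gt_0_nat[OF p(1)]
  by (auto simp: artin_schreier_def zero_power intro!: image_eqI[of _ _ 0])

lemma artin_schreier_sum:
  "(\<And>i. i \<in> A \<Longrightarrow> f i \<in> artin_schreier p) \<Longrightarrow> sum f A \<in> (artin_schreier p :: 'b set)"
  by (induction A rule: infinite_finite_induct) (auto simp: artin_schreier_0 artin_schreier_add)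

text \<open>A telescoping sum of the images of \<open>c ^ (p ^ i)\<close> for
  \<open>i < k\<close>.\<close>

lemma artin_schreier_frobenius: "c ^ (p ^ k) - c \<in> (artin_schreier p :: 'b set)"
proof (induction k)
  case 0
  then show ?case by (simp add: artin_schreier_0)
next
  case (Suc k)
  have "(c ^ (p ^ k)) ^ p - c ^ (p ^ k) \<in> artin_schreier p"
    unfolding artin_schreier_def by blast
  from artin_schreier_add[OF this Suc] show ?case
    by (simp add: mult.commute flip: power_mult)
qed

end

text \<open>The powers \<open>\<alpha> i ^ e l\<close> form a generalized Vandermonde matrix. It is
  kept invertible by choosing each new point off the roots of a nonzero polynomial, which is
  possible in an infinite \<open>A\<close>.\<close>

lemma generic_interpolation:
  fixes A :: "'b::field set" and e :: "nat \<Rightarrow> nat"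
  assumes "infinite A" "inj e"
  shows "\<exists>\<alpha>. (\<forall>i. \<alpha> i \<in> A) \<and> (\<forall>\<tau>. \<exists>g. \<forall>i<n. (\<Sum>l<n. g l * \<alpha> i ^ e l) = \<tau> i)"
proof (induction n)
  case 0
  obtain a where "a \<in> A"
    using assms(1) by fastforce
  then show ?case by (intro exI[of _ "\<lambda>_. a"]) simp
next
  case (Suc n)
  then obtain \<alpha> where \<alpha>: "\<And>i. \<alpha> i \<in> A"
      "\<And>\<tau>. \<exists>g. \<forall>i<n. (\<Sum>l<n. g l * \<alpha> i ^ e l) = \<tau> i"
    by blast
  obtain g where g: "\<forall>i<n. (\<Sum>l<n. g l * \<alpha> i ^ e l) = - (\<alpha> i ^ e n)"
    using \<alpha>(2)[of "\<lambda>i. - (\<alpha> i ^ e n)"] by blast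
  \<comment> \<open>\<open>F\<close> vanishes at the old points by the choice of \<open>g\<close>,
    and its coefficient at \<open>e n\<close> is 1. Adding a multiple of it adjusts the value at the
    new point alone.\<close>
  define F where "F = monom 1 (e n) + (\<Sum>l<n. monom (g l) (e l))"
  have poly_F: "poly F a = a ^ e n + (\<Sum>l<n. g l * a ^ e l)" for a
    by (simp add: F_def poly_monom poly_sum)
  have "coeff F (e n) = 1 + (\<Sum>l<n. if e l = e n then g l else 0)"
    by (simp add: F_def coeff_sum)
  also have "(\<Sum>l<n. if e l = e n then g l else 0) = 0"
    using assms(2) by (intro sum.neutral) (auto dest: injD)
  finally have "F \<noteq> 0"
    by auto
  then have "finite {a. poly F a = 0}"
    by (rule poly_roots_finite)
  then obtain \<beta> where \<beta>: "\<beta> \<in> A" "poly F \<beta> \<noteq> 0"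
    using assms(1) by (metis (mono_tags, lifting) finite_subset mem_Collect_eq subsetI)
  have "\<exists>h. \<forall>i<Suc n. (\<Sum>l<Suc n. h l * (\<alpha>(n := \<beta>)) i ^ e l) = \<tau> i" for \<tau>
  proof -
    obtain g' where g': "\<forall>i<n. (\<Sum>l<n. g' l * \<alpha> i ^ e l) = \<tau> i"
      using \<alpha>(2) by blast
    define c where "c = (\<tau> n - (\<Sum>l<n. g' l * \<beta> ^ e l)) / poly F \<beta>"
    define h where "h l = (if l < n then g' l + c * g l else c)" for l
    have h: "(\<Sum>l<Suc n. h l * a ^ e l) = (\<Sum>l<n. g' l * a ^ e l) + c * poly F a" for a
      by (simp add: h_def poly_F algebra_simps sum.distrib sum_distrib_left)
    have "(\<Sum>l<Suc n. h l * \<alpha> i ^ e l) = \<tau> i" if "i < n" for i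
      unfolding h using that g g' by (simp add: poly_F)
    moreover have "(\<Sum>l<Suc n. h l * \<beta> ^ e l) = \<tau> n"
      unfolding h using \<beta>(2) by (simp add: c_def)
    ultimately show ?thesis
      by (intro exI[of _ h]) (auto simp: less_Suc_eq)
  qed
  then show ?case
    using \<alpha>(1) \<beta>(1) by (intro exI[of _ "\<alpha>(n := \<beta>)"]) auto
qed

section \<open>Formulas over the ring for statements about fractions\<close>

lemma to_fract_power [simp]: "to_fract (x ^ n) = to_fract x ^ n"
  by (induction n) auto

lemma to_fract_cases:
  obtains a b where "b \<noteq> 0" "x = to_fract a / to_fract b"
  by (cases x) (auto simp: Fract_conv_to_fract)

text \<open>\<open>rpower t n\<close> is a term for \<open>t ^ (n + 1)\<close>, as the language has no constant \<open>1\<close>.\<close>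

primrec rpower :: "rterm \<Rightarrow> nat \<Rightarrow> rterm" where
  "rpower t 0 = t"
| "rpower t (Suc n) = RMul t (rpower t n)"

lemma teval_rpower [simp]: "teval e (rpower t n) = teval e t ^ Suc n"
  by (induction n) auto

text \<open>Multiplication by \<open>z * w ^ p\<close> clears denominators, with
  \<open>v / w\<close> as the Artin--Schreier preimage. Membership thus becomes a formula over the
  ring in \<open>x\<close>, \<open>y\<close>, \<open>z\<close>.\<close>

lemma artin_schreier_fract_iff:
  fixes x y z :: "'a::idom"
  assumes "z \<noteq> 0" "p \<ge> 1"
  shows "to_fract x * (to_fract y / to_fract z) \<in> artin_schreier p \<longleftrightarrow>
    (\<exists>v w. w \<noteq> 0 \<and> x * y * w ^ p + z * v * w ^ (p - 1) = z * v ^ p)"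
proof -
  have *: "to_fract x * (to_fract y / to_fract z) = (to_fract v / to_fract w) ^ p - to_fract v / to_fract w
      \<longleftrightarrow> x * y * w ^ p + z * v * w ^ (p - 1) = z * v ^ p" if w: "w \<noteq> 0" for v w
  proof -
    have wp: "w ^ p = w * w ^ (p - 1)"
      using assms(2) by (cases p) auto
    have "to_fract x * (to_fract y / to_fract z) = (to_fract v / to_fract w) ^ p - to_fract v / to_fract w
      \<longleftrightarrow> to_fract (x * y * w ^ p + z * v * w ^ (p - 1)) = to_fract (z * v ^ p)"
      using w assms(1) unfolding power_divide wp to_fract_power[symmetric] to_fract_mult to_fract_add
      by (simp add: field_simps)
    then show ?thesis
      by (simp only: to_fract_eq_iff)
  qed
  show ?thesis
  proof
    assume "to_fract x * (to_fract y / to_fract z) \<in> artin_schreier p"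
    then obtain q where q: "to_fract x * (to_fract y / to_fract z) = q ^ p - q"
      by (auto simp: artin_schreier_def)
    obtain v w where "w \<noteq> 0" "q = to_fract v / to_fract w"
      by (rule to_fract_cases)
    with q * show "\<exists>v w. w \<noteq> 0 \<and> x * y * w ^ p + z * v * w ^ (p - 1) = z * v ^ p"
      by blast
  next
    assume "\<exists>v w. w \<noteq> 0 \<and> x * y * w ^ p + z * v * w ^ (p - 1) = z * v ^ p"
    with * show "to_fract x * (to_fract y / to_fract z) \<in> artin_schreier p"
      unfolding artin_schreier_def by blast
  qed
qed

text \<open>The theorem of Kaplan, Scanlon and Wagner for the fraction field. If \<open>u\<close> is not of the form
  \<open>z ^ p - z\<close>, then \<open>a i * b S \<in> artin_schreier p\<close> has the independence property for
  \<open>a i = \<alpha> i ^ (p ^ n)\<close> and \<open>b S = (\<Sum>l<n. (g l * u) ^ (p ^ (n - l)))\<close>: up to Artin--Schreier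
  elements, \<open>a i * b S\<close> equals \<open>(\<Sum>l<n. \<alpha> i ^ (p ^ l) * g l) * u\<close>, and for generic \<open>\<alpha>\<close> the
  values of the sum at all \<open>i\<close> can be prescribed.\<close>

theorem NIP_fract_artin_schreier_closed:
  fixes u :: "'a::idom fract"
  assumes NIP: "NIP_ring TYPE('a)" and inf: "infinite (UNIV :: 'a set)"
    and p: "prime p" "of_nat p = (0 :: 'a fract)"
  shows "\<exists>z. z ^ p - z = u"
proof (rule ccontr)
  assume "\<not> ?thesis"
  then have u: "u \<notin> artin_schreier p"
    by (auto simp: artin_schreier_def)
  have p2: "p \<ge> 2"
    using p(1) by (rule prime_ge_2_nat)
  define P where "P x y z \<longleftrightarrow> (\<exists>v w. w \<noteq> 0 \<and> x * y * w ^ p + z * v * w ^ (p - 1) = z * v ^ p)"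
    for x y z :: 'a
  \<comment> \<open>Variables 0, 1, 2 are \<open>x\<close>, \<open>y\<close>, \<open>z\<close>; 3
    and 4 are \<open>v\<close>, \<open>w\<close>. For lack of a constant 0, nonvanishing of
    \<open>w\<close> is expressed by \<open>w + w \<noteq> w\<close>. The exponents are shifted by
    one as \<open>rpower\<close> requires.\<close>
  define \<phi> where "\<phi> = REx 3 (REx 4 (RAnd (RNot (REq (RAdd (RVar 4) (RVar 4)) (RVar 4)))
    (REq (RAdd (RMul (RMul (RVar 0) (RVar 1)) (rpower (RVar 4) (p - 1)))
      (RMul (RMul (RVar 2) (RVar 3)) (rpower (RVar 4) (p - 2))))
    (RMul (RVar 2) (rpower (RVar 3) (p - 1))))))"
  have [simp]: "Suc (p - Suc 0) = p" "Suc (p - 2) = p - Suc 0"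
    using p2 by auto
  have [simp]: "(2 :: 'a) \<noteq> 1"
    using add_left_cancel[of 1 1 "0 :: 'a"] by (auto simp del: add_left_cancel)
  have sat: "sat e \<phi> \<longleftrightarrow> P (e 0) (e 1) (e 2)" for e :: "nat \<Rightarrow> 'a"
    by (simp add: \<phi>_def P_def del: power_Suc)
  obtain n where n: "\<forall>(a :: nat \<Rightarrow> 'a) b c. \<exists>i<n. \<exists>S\<subseteq>{..<n}. \<not> (P (a i) (b S) (c S) \<longleftrightarrow> i \<in> S)"
    using NIP_not_shattered[where P = P, OF NIP sat] ..
  have "infinite (range (to_fract :: 'a \<Rightarrow> 'a fract))"
    using inf by (simp add: finite_image_iff inj_def)
  moreover have "inj (\<lambda>l. p ^ l)"
    using p2 by (auto simp: inj_def)
  ultimately have "\<exists>\<alpha>. (\<forall>i. \<alpha> i \<in> range (to_fract :: 'a \<Rightarrow> 'a fract)) \<and>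
      (\<forall>\<tau>. \<exists>g. \<forall>i<n. (\<Sum>l<n. g l * \<alpha> i ^ (p ^ l)) = \<tau> i)"
    by (rule generic_interpolation)
  then obtain \<alpha> where \<alpha>: "\<forall>i. \<alpha> i \<in> range (to_fract :: 'a \<Rightarrow> 'a fract)"
      "\<forall>\<tau>. \<exists>g. \<forall>i<n. (\<Sum>l<n. g l * \<alpha> i ^ (p ^ l)) = \<tau> i"
    by (elim exE conjE) (rule that)
  have "\<exists>a. \<alpha> i = to_fract a" for i
    using spec[OF \<alpha>(1), of i] by (simp add: image_iff)
  then obtain \<alpha>' where \<alpha>': "\<And>i. \<alpha> i = to_fract (\<alpha>' i)"
    by metis
  \<comment> \<open>With the values 0 on \<open>S\<close> and 1 elsewhere,
    \<open>\<alpha> i ^ (p ^ n) * b S\<close> becomes 0 or \<open>u\<close> modulo Artin--Schreier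
    elements.\<close>
  have "\<exists>g. \<forall>i<n. (\<Sum>l<n. g l * \<alpha> i ^ (p ^ l)) = (if i \<in> S then 0 else 1)" for S
    by (rule spec[OF \<alpha>(2)])
  then obtain g where g: "\<And>S i. i < n \<Longrightarrow> (\<Sum>l<n. g S l * \<alpha> i ^ (p ^ l)) = (if i \<in> S then 0 else 1)"
    by metis
  define b where "b S = (\<Sum>l<n. (g S l * u) ^ (p ^ (n - l)))" for S
  have b: "\<alpha> i ^ (p ^ n) * b S \<in> artin_schreier p \<longleftrightarrow> i \<in> S" if i: "i < n" for i S
  proof -
    define c where "c l = \<alpha> i ^ (p ^ l) * (g S l * u)" for l
    have "(\<alpha> i ^ (p ^ n)) * (g S l * u) ^ (p ^ (n - l)) = c l ^ (p ^ (n - l))" if "l < n" for l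
      using that by (simp add: c_def power_mult_distrib flip: power_mult power_add)
    then have "\<alpha> i ^ (p ^ n) * b S = (\<Sum>l<n. c l ^ (p ^ (n - l)))"
      by (simp add: b_def sum_distrib_left)
    moreover have "(\<Sum>l<n. c l) = (if i \<in> S then 0 else u)"
      using g[OF i, of S] by (simp add: c_def mult_ac flip: sum_distrib_right sum_distrib_left)
    ultimately have diff: "\<alpha> i ^ (p ^ n) * b S - (if i \<in> S then 0 else u) =
        (\<Sum>l<n. c l ^ (p ^ (n - l)) - c l)"
      by (simp add: sum_subtractf)
    have "\<dots> \<in> artin_schreier p"
      by (intro artin_schreier_sum artin_schreier_frobenius p)
    with diff have *: "\<alpha> i ^ (p ^ n) * b S - (if i \<in> S then 0 else u) \<in> artin_schreier p"
      by (simp only:)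
    show ?thesis
    proof (cases "i \<in> S")
      case True
      with * show ?thesis by simp
    next
      case False
      then show ?thesis
        using * u artin_schreier_diff[OF p, of "\<alpha> i ^ (p ^ n) * b S" "\<alpha> i ^ (p ^ n) * b S - u"]
        by auto
    qed
  qed
  \<comment> \<open>Numerator and denominator of \<open>b S\<close> serve as the two parameters of
    the formula.\<close>
  have "\<forall>S. \<exists>y z. z \<noteq> 0 \<and> b S = to_fract y / to_fract z"
    by (metis to_fract_cases)
  then obtain y z where yz: "\<And>S. z S \<noteq> 0" "\<And>S. b S = to_fract (y S) / to_fract (z S)"
    by metis
  have "P (\<alpha>' i ^ (p ^ n)) (y S) (z S) \<longleftrightarrow> i \<in> S" if "i < n" for i S
    using b[OF that, of S] p2 artin_schreier_fract_iff[OF yz(1), of p "\<alpha>' i ^ (p ^ n)" "y S" S]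
    by (simp add: P_def \<alpha>' yz(2))
  then have "\<not> (\<exists>i<n. \<exists>S\<subseteq>{..<n}. \<not> (P (\<alpha>' i ^ (p ^ n)) (y S) (z S) \<longleftrightarrow> i \<in> S))"
    by simp
  then show False
    using n[THEN spec, of "\<lambda>i. \<alpha>' i ^ (p ^ n)", THEN spec, of y, THEN spec, of z] by (rule notE)
qed

section \<open>Almost integral elements\<close>

lemma range_to_fract_add: "x \<in> range to_fract \<Longrightarrow> y \<in> range to_fract \<Longrightarrow> x + y \<in> range to_fract"
  by (auto simp flip: to_fract_add)

lemma range_to_fract_mult: "x \<in> range to_fract \<Longrightarrow> y \<in> range to_fract \<Longrightarrow> x * y \<in> range to_fract"
  by (auto simp flip: to_fract_mult)

lemma to_fract_of_nat: "to_fract (of_nat n) = of_nat n"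
  by (induction n) auto

lemma range_to_fract_sum: "(\<And>i. i \<in> A \<Longrightarrow> f i \<in> range to_fract) \<Longrightarrow> sum f A \<in> range to_fract"
proof (induction A rule: infinite_finite_induct)
  case empty
  then show ?case by (metis rangeI sum.empty to_fract_0)
next
  case (infinite A)
  then show ?case by (metis rangeI sum.infinite to_fract_0)
qed (auto intro: range_to_fract_add)

text \<open>The complete integral closure, which for a Noetherian domain is the integral closure in
  the fraction field. Only a common denominator of all powers has to be exhibited, no integral
  equation.\<close>

definition almost_integral :: "'a::idom fract set" where
  "almost_integral = {x. \<exists>c. c \<noteq> 0 \<and> (\<forall>m. to_fract c * x ^ m \<in> range to_fract)}"

lemma almost_integral_to_fract [simp]: "to_fract a \<in> almost_integral"
  unfolding almost_integral_def
  by (auto intro!: exI[of _ 1] simp flip: to_fract_power)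

lemma almost_integral_1 [simp]: "1 \<in> almost_integral"
  using almost_integral_to_fract[of 1] by simp

lemma almost_integral_mult:
  assumes "x \<in> almost_integral" "y \<in> almost_integral"
  shows "x * y \<in> almost_integral"
proof -
  obtain c d where "c \<noteq> 0" "d \<noteq> 0"
    and cd: "\<And>m. to_fract c * x ^ m \<in> range to_fract" "\<And>m. to_fract d * y ^ m \<in> range to_fract"
    using assms by (auto simp: almost_integral_def)
  have "to_fract (c * d) * (x * y) ^ m = (to_fract c * x ^ m) * (to_fract d * y ^ m)" for m
    by (simp add: power_mult_distrib)
  then have "to_fract (c * d) * (x * y) ^ m \<in> range to_fract" for m
    using range_to_fract_mult[OF cd] by (simp only:)
  then show ?thesis
    unfolding almost_integral_def using \<open>c \<noteq> 0\<close> \<open>d \<noteq> 0\<close>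
    by (intro CollectI exI[of _ "c * d"]) simp
qed

lemma almost_integral_add:
  assumes "x \<in> almost_integral" "y \<in> almost_integral"
  shows "x + y \<in> almost_integral"
proof -
  obtain c d where "c \<noteq> 0" "d \<noteq> 0"
    and cd: "\<And>m. to_fract c * x ^ m \<in> range to_fract" "\<And>m. to_fract d * y ^ m \<in> range to_fract"
    using assms by (auto simp: almost_integral_def)
  have "to_fract (c * d) * (x + y) ^ m \<in> range to_fract" for m
  proof -
    have "to_fract (c * d) * (x + y) ^ m =
        (\<Sum>k\<le>m. of_nat (m choose k) * ((to_fract c * x ^ k) * (to_fract d * y ^ (m - k))))"
      by (simp add: binomial_ring sum_distrib_left mult_ac)
    also have "\<dots> \<in> range to_fract"
      by (intro range_to_fract_sum range_to_fract_mult cd) (metis rangeI to_fract_of_nat)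
    finally show ?thesis .
  qed
  then show ?thesis
    unfolding almost_integral_def using \<open>c \<noteq> 0\<close> \<open>d \<noteq> 0\<close>
    by (intro CollectI exI[of _ "c * d"]) simp
qed

lemma almost_integral_diff:
  assumes "x \<in> almost_integral" "y \<in> almost_integral"
  shows "x - y \<in> almost_integral"
  using almost_integral_add[OF assms(1) almost_integral_mult[OF almost_integral_to_fract[of "- 1"] assms(2)]]
  by simp

lemma almost_integral_power: "x \<in> almost_integral \<Longrightarrow> x ^ n \<in> almost_integral"
  by (induction n) (auto intro: almost_integral_mult)

text \<open>The equation trades \<open>w ^ m\<close> for \<open>w ^ (m - p)\<close> and
  \<open>w ^ (m - p + j)\<close> at the cost of one factor \<open>h\<close>. A denominator for the
  powers of \<open>h\<close> times one for the powers of \<open>w\<close> below \<open>p\<close>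
  therefore works for all powers of \<open>w\<close>. The shape covers both \<open>v\<close> and
  \<open>w * y\<close> in the later descent.\<close>

lemma almost_integral_root:
  assumes h: "h \<in> almost_integral" and j: "j < p" and w: "w ^ p = h * (1 + to_fract e * w ^ j)"
  shows "w \<in> almost_integral"
proof -
  obtain c where c: "c \<noteq> 0" "\<And>m. to_fract c * h ^ m \<in> range to_fract"
    using h by (auto simp: almost_integral_def)
  obtain a b where ab: "b \<noteq> 0" "w = to_fract a / to_fract b"
    by (rule to_fract_cases)
  define d where "d = b ^ p"
  have d: "to_fract d * w ^ m \<in> range to_fract" if "m < p" for m
  proof -
    have "to_fract d = to_fract b ^ (p - m) * to_fract b ^ m"
      using that by (simp add: d_def flip: power_add)
    then have "to_fract d * w ^ m = to_fract (b ^ (p - m) * a ^ m)"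
      using ab by (simp add: power_divide)
    then show ?thesis
      by (simp only: rangeI)
  qed
  have *: "to_fract (c * d) * h ^ i * w ^ m \<in> range to_fract" for i m
  proof (induction m arbitrary: i rule: less_induct)
    case (less m)
    show ?case
    proof (cases "m < p")
      case True
      then show ?thesis
        using range_to_fract_mult[OF c(2)[of i] d] by (simp add: mult_ac)
    next
      case False
      then have "w ^ m = w ^ (m - p) * (h * (1 + to_fract e * w ^ j))"
        unfolding w[symmetric] by (simp flip: power_add)
      then have "to_fract (c * d) * h ^ i * w ^ m = to_fract (c * d) * h ^ Suc i * w ^ (m - p)
          + to_fract e * (to_fract (c * d) * h ^ Suc i * w ^ (m - p + j))"
        by (simp add: algebra_simps power_add)
      then show ?thesis
        using less[of "m - p" "Suc i"] less[of "m - p + j" "Suc i"] False j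
          range_to_fract_mult[OF rangeI[of to_fract e]]
        by (simp only:) (intro range_to_fract_add; simp)
    qed
  qed
  show ?thesis
    unfolding almost_integral_def using c(1) ab(1) *[of 0]
    by (intro CollectI exI[of _ "c * d"]) (simp add: d_def)
qed

section \<open>Divisibility in Noetherian domains and the Krull--Akizuki argument\<close>

lemma ring_ideal_multiples: "ring_ideal {r. a dvd r}"
  by (auto simp: ring_ideal_def)

lemma multiples_eq_0D: "{r. a dvd r} = {0} \<Longrightarrow> a = (0 :: 'a::comm_ring_1)"
proof -
  assume "{r. a dvd r} = {0}"
  moreover have "a \<in> {r. a dvd r}"
    by simp
  ultimately show "a = 0"
    by (simp only: singleton_iff)
qed

text \<open>A denominator \<open>c\<close> for all powers of the inverse of \<open>t\<close> is
  \<open>t ^ m * a m\<close> for every \<open>m\<close>. The principal ideals of the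
  \<open>a m\<close> ascend, and where they stop, \<open>t\<close> would be a unit.\<close>

lemma inverse_not_almost_integral:
  assumes noeth: "noetherian TYPE('a::idom)" and t: "t \<noteq> 0" "\<not> t dvd (1 :: 'a)"
  shows "1 / to_fract t \<notin> almost_integral"
proof
  assume "1 / to_fract t \<in> almost_integral"
  then obtain c where c: "c \<noteq> 0" "\<And>m. to_fract c * (1 / to_fract t) ^ m \<in> range to_fract"
    by (auto simp: almost_integral_def)
  have "\<exists>a. c = t ^ m * a" for m
  proof -
    obtain a where "to_fract c * (1 / to_fract t) ^ m = to_fract a"
      using c(2)[of m] by auto
    then have "to_fract c = to_fract (t ^ m * a)"
      using t(1) by (simp add: power_divide field_simps)
    then show ?thesis
      by (metis to_fract_eq_iff)
  qed
  then obtain a where a: "\<And>m. c = t ^ m * a m"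
    by metis
  have step: "a m = t * a (Suc m)" for m
    using a[of m] a[of "Suc m"] t(1) by (simp add: mult.assoc)
  have "mono (\<lambda>m. {r. a m dvd r})"
  proof (intro incseq_SucI subsetI)
    fix m r assume "r \<in> {r. a m dvd r}"
    moreover have "a (Suc m) dvd a m"
      using step[of m] by (metis dvd_triv_right)
    ultimately show "r \<in> {r. a (Suc m) dvd r}"
      by (auto intro: dvd_trans)
  qed
  then obtain N where N: "\<forall>n\<ge>N. {r. a n dvd r} = {r. a N dvd r}"
    using noeth[unfolded noetherian_def, THEN spec, of "\<lambda>m. {r. a m dvd r}"]
    by (auto simp: ring_ideal_multiples)
  have eq: "{r. a (Suc N) dvd r} = {r. a N dvd r}"
    using N[rule_format, of "Suc N"] by simp
  have "a (Suc N) \<in> {r. a (Suc N) dvd r}"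
    by simp
  then have "a N dvd a (Suc N)"
    unfolding eq by simp
  then obtain k where "a (Suc N) = a N * k"
    by (elim dvdE)
  then have "a (Suc N) = a (Suc N) * (t * k)"
    unfolding step[of N] by (simp only: mult_ac)
  moreover have "a (Suc N) \<noteq> 0"
    using a[of "Suc N"] c(1) by auto
  ultimately have "1 = t * k"
    by simp
  with t(2) show False by (metis dvdI)
qed

text \<open>By Noetherian induction every nonzero ideal contains a power of \<open>t\<close>: for a
  non-prime \<open>I\<close>, powers in \<open>I\<close> + (\<open>a\<close>) and \<open>I\<close> +
  (\<open>b\<close>) multiply into \<open>I\<close>.\<close>

lemma dvd_power_of_radical:
  assumes noeth: "noetherian TYPE('a::idom)"
    and t: "\<And>P. prime_ideal P \<Longrightarrow> P \<noteq> {0} \<Longrightarrow> (t :: 'a) \<in> P" and c: "c \<noteq> 0"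
  shows "\<exists>m. c dvd t ^ m"
proof -
  have *: "I \<noteq> {0} \<longrightarrow> (\<exists>m. t ^ m \<in> I)" if "ring_ideal I" for I :: "'a set"
    using noeth that
  proof (induction rule: noetherian_induct)
    case (step I)
    show ?case
    proof
      assume "I \<noteq> {0}"
      consider "I = UNIV" | "prime_ideal I" | "I \<noteq> UNIV" "\<not> prime_ideal I" by blast
      then show "\<exists>m. t ^ m \<in> I"
      proof cases
        case 1
        then show ?thesis by simp
      next
        case 2
        then have "t ^ 1 \<in> I"
          using t \<open>I \<noteq> {0}\<close> by simp
        then show ?thesis ..
      next
        case 3
        then obtain a b where ab: "a \<notin> I" "b \<notin> I" "a * b \<in> I"
          using not_prime_idealE[OF step.hyps] by blast
        have "\<exists>m. t ^ m \<in> ideal_insert x I" if "x \<notin> I" for x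
        proof -
          have sub: "I \<subset> ideal_insert x I"
            using ideal_insert[OF step.hyps, of x] that by blast
          have "ideal_insert x I \<noteq> {0}"
          proof
            assume "ideal_insert x I = {0}"
            with sub ring_ideal_0[OF step.hyps] show False
              by auto
          qed
          then show ?thesis
            using step.IH[OF ideal_insert(1)[OF step.hyps] sub] by simp
        qed
        then obtain m n where "t ^ m \<in> ideal_insert a I" "t ^ n \<in> ideal_insert b I"
          using ab(1,2) by blast
        then obtain x y r s where xy: "x \<in> I" "y \<in> I" "t ^ m = x + r * a" "t ^ n = y + s * b"
          by (auto simp: ideal_insert_def)
        have "t ^ (m + n) = (y + s * b) * x + (r * a) * y + (r * s) * (a * b)"
          unfolding power_add xy(3,4) by (simp add: algebra_simps)
        also have "\<dots> \<in> I"
          using xy(1,2) ab(3) step.hyps by (simp only: ring_ideal_add ring_ideal_mult)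
        finally show ?thesis ..
      qed
    qed
  qed
  have "{r. c dvd r} \<noteq> {0}"
    using c multiples_eq_0D[of c] by (rule contrapos_nn)
  then show ?thesis
    using *[OF ring_ideal_multiples[of c]] by blast
qed

text \<open>The essential step of the Krull--Akizuki theorem: \<open>t ^ l B / t ^ (l + 1) B\<close> is a subquotient
  of the ring, where \<open>B\<close> is the ring of almost integral elements.\<close>

lemma krull_akizuki:
  assumes noeth: "noetherian TYPE('a::idom)" and t: "t \<noteq> 0"
    and radical: "\<And>P. prime_ideal P \<Longrightarrow> P \<noteq> {0} \<Longrightarrow> (t :: 'a) \<in> P"
    and dim: "\<And>P :: 'a set. prime_ideal P \<Longrightarrow> P \<noteq> {0} \<Longrightarrow> maximal_ideal P"
  obtains l where "\<And>b. b \<in> almost_integral \<Longrightarrow>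
    \<exists>a. \<exists>b'\<in>almost_integral. to_fract t ^ l * b = to_fract a + to_fract t ^ Suc l * b'"
proof -
  define \<theta> where "\<theta> = to_fract t"
  have \<theta>: "\<theta> \<noteq> 0" "\<theta> \<in> almost_integral"
    using t by (auto simp: \<theta>_def)
  \<comment> \<open>The contraction of \<open>t R + t ^ n B\<close> to the ring \<open>R\<close>,
    with \<open>B\<close> the ring of almost integral elements.\<close>
  define A where "A n = {a. \<exists>e. \<exists>b\<in>almost_integral. to_fract a = to_fract e * \<theta> + \<theta> ^ n * b}" for n
  have A_ideal: "ring_ideal (A n)" for n
    unfolding ring_ideal_def
  proof (intro conjI ballI allI)
    show "0 \<in> A n"
      unfolding A_def using almost_integral_to_fract[of 0]
      by (intro CollectI exI[of _ 0] bexI[of _ 0]) simp_all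
  next
    fix x y assume "x \<in> A n" "y \<in> A n"
    then obtain e f b c where "b \<in> almost_integral" "c \<in> almost_integral"
      "to_fract x = to_fract e * \<theta> + \<theta> ^ n * b" "to_fract y = to_fract f * \<theta> + \<theta> ^ n * c"
      by (auto simp: A_def)
    then have "b + c \<in> almost_integral" "to_fract (x + y) = to_fract (e + f) * \<theta> + \<theta> ^ n * (b + c)"
      by (auto simp: almost_integral_add algebra_simps)
    then show "x + y \<in> A n"
      unfolding A_def by blast
  next
    fix r x assume "x \<in> A n"
    then obtain e b where "b \<in> almost_integral" "to_fract x = to_fract e * \<theta> + \<theta> ^ n * b"
      by (auto simp: A_def)
    then have "to_fract r * b \<in> almost_integral"
      "to_fract (r * x) = to_fract (r * e) * \<theta> + \<theta> ^ n * (to_fract r * b)"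
      by (auto simp: almost_integral_mult algebra_simps)
    then show "r * x \<in> A n"
      unfolding A_def by blast
  qed
  \<comment> \<open>Nonzero primes are maximal, so ideals containing \<open>t\<close> satisfy the
    descending chain condition; for \<open>S = {1}\<close> every ideal is saturated.\<close>
  have "\<exists>N. \<forall>n\<ge>N. A n = A N"
  proof (rule noetherian_saturated_dcc[of "{1}", OF _ _ noeth])
    show "J = I \<or> J = UNIV" if "prime_ideal I" "t \<in> I" "ring_ideal J" "I \<subseteq> J" for I J
      using dim[OF that(1)] that t by (auto simp: maximal_ideal_def)
    show "saturated {1} (A n)" for n
      by (simp add: saturated_def)
    show "t \<in> A n" for n
      unfolding A_def using almost_integral_to_fract[of 0]
      by (intro CollectI exI[of _ 1] bexI[of _ 0]) (simp_all add: \<theta>_def)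
    have "A (Suc n) \<subseteq> A n" for n
    proof
      fix x assume "x \<in> A (Suc n)"
      then obtain e b where "b \<in> almost_integral" "to_fract x = to_fract e * \<theta> + \<theta> ^ Suc n * b"
        by (auto simp: A_def)
      then have "\<theta> * b \<in> almost_integral" "to_fract x = to_fract e * \<theta> + \<theta> ^ n * (\<theta> * b)"
        using \<theta>(2) by (auto simp: almost_integral_mult mult_ac)
      then show "x \<in> A n"
        unfolding A_def by blast
    qed
    then show "antimono A"
      by (rule decseq_SucI)
  qed (use A_ideal in auto)
  then obtain l where l: "\<forall>n\<ge>l. A n = A l" ..
  define good where "good b \<longleftrightarrow> (\<exists>a. \<exists>b'\<in>almost_integral. \<theta> ^ l * b = to_fract a + \<theta> ^ Suc l * b')" for b
  have good: "good b" if "b \<in> almost_integral" "\<theta> ^ m * b \<in> range to_fract" for b m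
    using that
  proof (induction m arbitrary: b)
    case 0
    then obtain a where "b = to_fract a"
      by auto
    then have "\<theta> ^ l * b = to_fract (t ^ l * a) + \<theta> ^ Suc l * to_fract 0"
      by (simp add: \<theta>_def)
    then show ?case
      unfolding good_def by (metis almost_integral_to_fract)
  next
    case (Suc m)
    then obtain a where a: "\<theta> ^ Suc m * b = to_fract a"
      by auto
    show ?case
    proof (cases "Suc m \<le> l")
      case True
      then have "\<theta> ^ l = \<theta> ^ (l - Suc m) * \<theta> ^ Suc m"
        by (simp del: power_Suc flip: power_add)
      then have "\<theta> ^ l * b = to_fract (t ^ (l - Suc m) * a) + \<theta> ^ Suc l * to_fract 0"
        by (simp add: mult.assoc flip: a) (simp add: \<theta>_def)
      then show ?thesis
        unfolding good_def by (metis almost_integral_to_fract)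
    next
      case False
      \<comment> \<open>Stationarity moves \<open>a\<close> into \<open>A (Suc (Suc m))\<close>,
        which provides \<open>b'\<close>; then \<open>\<theta> ^ m\<close> already carries
        \<open>b - \<theta> * b'\<close> into the ring.\<close>
      then have "A (Suc m) = A l" "A (Suc (Suc m)) = A l"
        using l[rule_format, of "Suc m"] l[rule_format, of "Suc (Suc m)"] by simp_all
      moreover have "a \<in> A (Suc m)"
        unfolding A_def using Suc.prems(1) a by (intro CollectI exI[of _ 0] bexI[of _ b]) simp_all
      ultimately have "a \<in> A (Suc (Suc m))"
        by simp
      then obtain e b' where b': "b' \<in> almost_integral" "to_fract a = to_fract e * \<theta> + \<theta> ^ Suc (Suc m) * b'"
        by (auto simp: A_def)
      have "\<theta> * (\<theta> ^ m * (b - \<theta> * b')) = \<theta> * to_fract e"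
        using b'(2) a by (simp add: algebra_simps)
      then have "\<theta> ^ m * (b - \<theta> * b') = to_fract e"
        using \<theta>(1) by simp
      moreover have "b - \<theta> * b' \<in> almost_integral"
        using Suc.prems(1) b'(1) \<theta>(2) by (intro almost_integral_diff almost_integral_mult)
      ultimately have "good (b - \<theta> * b')"
        using Suc.IH by simp
      then obtain d b'' where "b'' \<in> almost_integral"
          "\<theta> ^ l * (b - \<theta> * b') = to_fract d + \<theta> ^ Suc l * b''"
        by (auto simp: good_def)
      then have "b'' + b' \<in> almost_integral" "\<theta> ^ l * b = to_fract d + \<theta> ^ Suc l * (b'' + b')"
        using b'(1) by (auto simp: almost_integral_add algebra_simps)
      then show ?thesis
        unfolding good_def by blast
    qed
  qed
  show thesis
  proof (rule that[of l])
    fix b :: "'a fract" assume b: "b \<in> almost_integral"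
    obtain x y where xy: "y \<noteq> 0" "b = to_fract x / to_fract y"
      by (rule to_fract_cases)
    obtain m k where "t ^ m = y * k"
      using dvd_power_of_radical[OF noeth radical xy(1)] by (auto elim!: dvdE)
    then have "\<theta> ^ m * b = to_fract (k * x)"
      using xy by (simp add: \<theta>_def flip: to_fract_power)
    then have "\<theta> ^ m * b \<in> range to_fract"
      by (simp only: rangeI)
    from good[OF b this]
    show "\<exists>a. \<exists>b'\<in>almost_integral. to_fract t ^ l * b = to_fract a + to_fract t ^ Suc l * b'"
      unfolding good_def \<theta>_def .
  qed
qed

text \<open>Given a non-unit \<open>w \<noteq> 0\<close> dividing \<open>t\<close> in the ring \<open>B\<close> of almost integral elements, solve
  \<open>y ^ p - y = 1 / w\<close> and put \<open>v = 1 / y\<close>. Then \<open>w\<close> is \<open>v ^ p\<close> up to a unit of \<open>B\<close>, and the ideal of all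
  ring elements in \<open>t ^ l v B\<close> is strictly larger than that of all ring elements in \<open>t ^ l w B\<close>.\<close>

theorem noetherian_not_artin_schreier_closed:
  assumes noeth: "noetherian TYPE('a::idom)" and t: "t \<noteq> 0" "\<not> t dvd 1"
    and radical: "\<And>P. prime_ideal P \<Longrightarrow> P \<noteq> {0} \<Longrightarrow> (t :: 'a) \<in> P"
    and dim: "\<And>P :: 'a set. prime_ideal P \<Longrightarrow> P \<noteq> {0} \<Longrightarrow> maximal_ideal P"
    and p: "p \<ge> 2"
  shows "\<exists>u :: 'a fract. \<forall>z. z ^ p - z \<noteq> u"
proof (rule ccontr)
  assume "\<not> ?thesis"
  then have closed: "\<exists>z. z ^ p - z = u" for u :: "'a fract"
    by auto
  let ?B = "almost_integral :: 'a fract set"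
  define \<theta> where "\<theta> = to_fract t"
  have \<theta>: "\<theta> \<noteq> 0" "\<theta> \<in> ?B" "1 / \<theta> \<notin> ?B"
    using t inverse_not_almost_integral[OF noeth t] by (auto simp: \<theta>_def)
  obtain l where l: "\<And>b. b \<in> ?B \<Longrightarrow> \<exists>a. \<exists>b'\<in>?B. \<theta> ^ l * b = to_fract a + \<theta> ^ Suc l * b'"
    unfolding \<theta>_def using krull_akizuki[OF noeth t(1) radical dim] by metis
  define L where "L w = {a. \<exists>b\<in>?B. to_fract a = \<theta> ^ l * w * b}" for w
  have L_ideal: "ring_ideal (L w)" for w
    unfolding ring_ideal_def
  proof (intro conjI ballI allI)
    show "0 \<in> L w"
      unfolding L_def using almost_integral_to_fract[of 0] by force
  next
    fix x y assume "x \<in> L w" "y \<in> L w"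
    then obtain b c where "b \<in> ?B" "c \<in> ?B" "to_fract x = \<theta> ^ l * w * b" "to_fract y = \<theta> ^ l * w * c"
      by (auto simp: L_def)
    then have "b + c \<in> ?B" "to_fract (x + y) = \<theta> ^ l * w * (b + c)"
      by (auto simp: almost_integral_add algebra_simps)
    then show "x + y \<in> L w"
      unfolding L_def by blast
  next
    fix r x assume "x \<in> L w"
    then obtain b where "b \<in> ?B" "to_fract x = \<theta> ^ l * w * b"
      by (auto simp: L_def)
    then have "to_fract r * b \<in> ?B" "to_fract (r * x) = \<theta> ^ l * w * (to_fract r * b)"
      by (auto simp: almost_integral_mult algebra_simps)
    then show "r * x \<in> L w"
      unfolding L_def by blast
  qed
  \<comment> \<open>No such \<open>w\<close> exists: the \<open>v\<close> built from
    \<open>w\<close> satisfies the same conditions and has a strictly larger ideal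
    \<open>L v\<close>.\<close>
  have "\<forall>w. w \<in> ?B \<longrightarrow> w \<noteq> 0 \<longrightarrow> 1 / w \<notin> ?B \<longrightarrow> \<theta> / w \<in> ?B \<longrightarrow> L w \<noteq> I" if "ring_ideal I" for I
    using noeth that
  proof (induction rule: noetherian_induct)
    case (step I)
    show ?case
    proof (intro allI impI notI)
      fix w assume w: "w \<in> ?B" "w \<noteq> 0" "1 / w \<notin> ?B" "\<theta> / w \<in> ?B" and I: "L w = I"
      obtain y where y: "y ^ p - y = 1 / w"
        using closed by blast
      have "y \<noteq> 0"
      proof
        assume "y = 0"
        then show False
          using y w(2) p by (simp add: zero_power)
      qed
      define v where "v = 1 / y"
      have v: "v \<noteq> 0" "y = 1 / v"
        using \<open>y \<noteq> 0\<close> by (auto simp: v_def)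
      have yp: "y ^ p = y * y ^ (p - 1)" "w ^ p = w * w ^ (p - 1)" "v ^ p = v * v ^ (p - 1)"
        using p by (cases p; simp)+
      have wyp: "w * y ^ p = 1 + w * y"
        using y w(2) by (simp add: field_simps)
      have v_root: "v ^ p = w * (1 + to_fract (- 1) * v ^ (p - 1))"
      proof -
        have "v ^ p * (w * y ^ p) = v ^ p * (1 + w * y)"
          by (simp only: wyp)
        also have "v ^ p * (w * y ^ p) = w"
          using \<open>y \<noteq> 0\<close> by (simp add: v_def power_divide)
        also have "v ^ p * (1 + w * y) = v ^ p + w * v ^ (p - 1)"
          unfolding yp(3) using v by (simp add: field_simps)
        finally show ?thesis
          by (simp add: algebra_simps)
      qed
      have vB: "v \<in> ?B"
        using w(1) v_root p by (intro almost_integral_root[of w "p - 1" p v "- 1"]) auto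
      \<comment> \<open>This equals \<open>w * y ^ p\<close>, so
        \<open>w = v ^ p * \<upsilon>\<close>. It is a unit of the ring of almost integral elements,
        with inverse \<open>1 - v ^ (p - 1)\<close>.\<close>
      define \<upsilon> where "\<upsilon> = 1 + w * y"
      have wy_root: "(w * y) ^ p = w ^ (p - 1) * (1 + to_fract 1 * (w * y) ^ 1)"
        using wyp by (simp add: power_mult_distrib yp(2) mult_ac)
      have "w * y \<in> ?B"
        by (rule almost_integral_root[OF almost_integral_power[OF w(1)] _ wy_root]) (use p in simp)
      then have \<upsilon>B: "\<upsilon> \<in> ?B"
        by (simp add: \<upsilon>_def almost_integral_add)
      have w_eq: "w = v ^ p * \<upsilon>"
        unfolding \<upsilon>_def wyp[symmetric] using \<open>y \<noteq> 0\<close> by (simp add: v_def power_divide)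
      have \<upsilon>_inv: "(1 - v ^ (p - 1)) * \<upsilon> = 1"
      proof -
        have "w * ((1 - v ^ (p - 1)) * \<upsilon>) = w * 1"
          using v_root w_eq by (metis (no_types, lifting) add_uminus_conv_diff minus_mult_left
              mult.assoc mult.right_neutral mult_1 to_fract_1 to_fract_uminus)
        then show ?thesis
          using w(2) by simp
      qed
      then have "\<upsilon> \<noteq> 0" by auto
      have w_div_v: "w / v = v ^ (p - 1) * \<upsilon>"
        unfolding w_eq yp(3) using v by simp
      have inv_v: "1 / v \<notin> ?B"
      proof
        assume "1 / v \<in> ?B"
        then have "(1 / v) ^ p * (1 - v ^ (p - 1)) \<in> ?B"
          using vB by (intro almost_integral_mult almost_integral_diff almost_integral_power) auto
        moreover have "1 / \<upsilon> = 1 - v ^ (p - 1)"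
          using \<upsilon>_inv \<open>\<upsilon> \<noteq> 0\<close> by (simp add: field_simps)
        then have "(1 / v) ^ p * (1 - v ^ (p - 1)) = 1 / w"
          unfolding w_eq by (simp only: power_divide power_one times_divide_times_eq mult_1_left flip: \<open>1 / \<upsilon> = 1 - v ^ (p - 1)\<close>)
        ultimately show False
          using w(3) by simp
      qed
      have \<theta>_v_eq: "\<theta> / v = (\<theta> / w) * (v ^ (p - 1) * \<upsilon>)"
        unfolding w_div_v[symmetric] using w(2) by simp
      have \<theta>_div_v: "\<theta> / v \<in> ?B"
        unfolding \<theta>_v_eq by (intro almost_integral_mult almost_integral_power w(4) vB \<upsilon>B)
      have "L w \<subseteq> L v"
      proof
        fix a assume "a \<in> L w"
        then obtain b where "b \<in> ?B" "to_fract a = \<theta> ^ l * w * b"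
          by (auto simp: L_def)
        moreover have "w = v * (v ^ (p - 1) * \<upsilon>)"
          using w_div_v v(1) by (simp add: field_simps)
        ultimately have "v ^ (p - 1) * \<upsilon> * b \<in> ?B" "to_fract a = \<theta> ^ l * v * (v ^ (p - 1) * \<upsilon> * b)"
          using vB \<upsilon>B by (simp_all add: almost_integral_mult almost_integral_power mult_ac)
        then show "a \<in> L v"
          unfolding L_def by blast
      qed
      \<comment> \<open>The ring element \<open>a\<close> congruent to
        \<open>\<theta> ^ l * v\<close> modulo \<open>\<theta> ^ Suc l\<close> lies in
        \<open>L v\<close> because \<open>\<theta> / v\<close> is almost integral. If it lay in
        \<open>L w\<close>, then \<open>v / w\<close>, and with it \<open>1 / v\<close>, would be
        almost integral.\<close>
      moreover have "L w \<noteq> L v"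
      proof
        assume Lwv: "L w = L v"
        obtain a b where b: "b \<in> ?B" and a: "\<theta> ^ l * v = to_fract a + \<theta> ^ Suc l * b"
          using l[OF vB] by blast
        have "to_fract a = \<theta> ^ l * v * (1 - (\<theta> / v) * b)"
          using a v(1) by (simp add: field_simps)
        moreover have "1 - (\<theta> / v) * b \<in> ?B"
          using b \<theta>_div_v by (intro almost_integral_diff almost_integral_mult) auto
        ultimately have "a \<in> L w"
          unfolding Lwv unfolding L_def by blast
        then obtain c where c: "c \<in> ?B" "to_fract a = \<theta> ^ l * w * c"
          by (auto simp: L_def)
        have "\<theta> ^ l * v = \<theta> ^ l * (w * ((\<theta> / w) * b + c))"
          unfolding a c(2) using w(2) by (simp add: field_simps)
        then have "v = w * ((\<theta> / w) * b + c)"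
          using \<theta>(1) by simp
        then have vw: "v / w = (\<theta> / w) * b + c"
          using w(2) by (metis nonzero_mult_div_cancel_left)
        have "v / w \<in> ?B"
          unfolding vw by (intro almost_integral_add almost_integral_mult w(4) b c(1))
        then have "v ^ (p - 2) * \<upsilon> * (v / w) \<in> ?B"
          using vB \<upsilon>B by (intro almost_integral_mult almost_integral_power)
        moreover have "v ^ p = v ^ (p - 2) * v * v"
          using p by (metis add_diff_inverse_nat leD mult.commute mult.assoc power2_eq_square power_add)
        then have "v ^ (p - 2) * \<upsilon> * (v / w) = 1 / v"
          using v(1) w(2) \<open>\<upsilon> \<noteq> 0\<close> unfolding w_eq by (simp add: field_simps)
        ultimately show False
          using inv_v by simp
      qed
      ultimately have "L w \<subset> L v"
        by blast
      then show False
        using step.IH[OF L_ideal[of v]] I vB v(1) inv_v \<theta>_div_v by blast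
    qed
  qed
  \<comment> \<open>The descent starts at \<open>w = \<theta>\<close>.\<close>
  from this[OF L_ideal[of \<theta>]] show False
    using \<theta> almost_integral_1 divide_self[OF \<theta>(1)] by metis
qed

section \<open>Primes, dimension and the final assembly\<close>

lemma finite_idom_is_field:
  assumes "finite (UNIV :: 'a::idom set)"
  shows "is_field_ring TYPE('a)"
  unfolding is_field_ring_def
proof (intro allI impI)
  fix x :: 'a assume "x \<noteq> 0"
  then have "inj ((*) x)"
    by (auto simp: inj_def)
  then have "surj ((*) x)"
    using assms finite_UNIV_inj_surj by blast
  then show "x dvd 1"
    by (metis dvdI surjD)
qed

lemma prime_ideal_zero: "prime_ideal {0 :: 'a::idom}"
proof -
  have "1 \<notin> {0 :: 'a}"
    by simp
  then have "{0 :: 'a} \<noteq> UNIV"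
    by blast
  then show ?thesis
    by (simp add: prime_ideal_def ring_ideal_def)
qed

lemma maximal_ideal_nonzero:
  assumes "\<not> is_field_ring TYPE('a::idom)" "maximal_ideal (M :: 'a set)"
  shows "M \<noteq> {0}"
proof
  assume "M = {0}"
  obtain x :: 'a where x: "x \<noteq> 0" "\<not> x dvd 1"
    using assms(1) by (auto simp: is_field_ring_def)
  have "\<forall>J :: 'a set. ring_ideal J \<longrightarrow> {0} \<subseteq> J \<longrightarrow> J = {0} \<or> J = UNIV"
    using assms(2) unfolding \<open>M = {0}\<close> maximal_ideal_def by (elim conjE)
  moreover have "{0} \<subseteq> {r. x dvd r}"
    by simp
  ultimately have "{r. x dvd r} = {0} \<or> {r. x dvd r} = UNIV"
    using ring_ideal_multiples[of x] by (elim allE impE)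
  then show False
  proof
    assume "{r. x dvd r} = {0}"
    with x(1) show False
      using multiples_eq_0D by blast
  next
    assume "{r. x dvd r} = UNIV"
    with x show False by auto
  qed
qed

text \<open>The chain from {0} to \<open>M\<close> gives the lower bound. In a chain of three primes
  the middle one is nonzero, hence maximal, and cannot lie strictly below the third.\<close>

lemma krull_dim_eq_1:
  assumes prime: "\<And>P :: 'a::idom set. prime_ideal P \<longleftrightarrow> P = {0} \<or> maximal_ideal P"
    and M: "maximal_ideal (M :: 'a set)" "M \<noteq> {0}"
  shows "krull_dim TYPE('a) = 1"
proof -
  define chains where "chains = {enat n | n. \<exists>P :: nat \<Rightarrow> 'a set.
       (\<forall>i\<le>n. prime_ideal (P i)) \<and> (\<forall>i<n. P i \<subset> P (Suc i))}"
  have "{0} \<subset> M"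
    using M ring_ideal_0[of M] by (auto simp: maximal_ideal_def)
  then have "enat 1 \<in> chains"
    unfolding chains_def
    by (intro CollectI exI[of _ 1] conjI exI[of _ "\<lambda>i :: nat. if i = 0 then {0} else M"])
      (use M(1) prime in auto)
  then have "1 \<le> Sup chains"
    by (simp add: Sup_upper one_enat_def)
  moreover have "Sup chains \<le> 1"
  proof (rule Sup_least)
    fix k assume "k \<in> chains"
    then obtain n and P :: "nat \<Rightarrow> 'a set" where k: "k = enat n"
      and P: "\<forall>i\<le>n. prime_ideal (P i)" "\<forall>i<n. P i \<subset> P (Suc i)"
      by (auto simp: chains_def)
    have "n \<le> 1"
    proof (rule ccontr)
      assume "\<not> n \<le> 1"
      then have "prime_ideal (P 0)" "prime_ideal (P 1)" "prime_ideal (P 2)" "P 0 \<subset> P 1" "P 1 \<subset> P 2"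
        using P(1) P(2)[rule_format, of 0] P(2)[rule_format, of 1] by (auto simp: numeral_2_eq_2)
      moreover from this have "P 1 \<noteq> {0}"
        using ring_ideal_0[OF prime_idealD(1), of "P 0"] by auto
      ultimately show False
        using prime[of "P 1"] by (auto simp: maximal_ideal_def prime_ideal_def)
    qed
    then show "k \<le> 1"
      by (simp add: k one_enat_def)
  qed
  ultimately show ?thesis
    unfolding krull_dim_def chains_def by (rule antisym[rotated])
qed

theorem theorem1p10:
  assumes "NIP_ring TYPE('a::idom)"
    and "noetherian TYPE('a)"
    and "\<not> is_field_ring TYPE('a)"
  shows "CHAR('a fract) = 0
         \<and> finite {M :: 'a set. maximal_ideal M}
         \<and> krull_dim TYPE('a) = 1
         \<and> {P :: 'a set. prime_ideal P} = insert {0} {M. maximal_ideal M}"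
proof -
  note NIP = assms(1) and noeth = assms(2) and not_field = assms(3)
  have dim: "maximal_ideal P" if "prime_ideal P" "P \<noteq> {0}" for P :: "'a set"
    using NIP_noetherian_prime_maximal[OF NIP noeth that] .
  have prime_iff: "prime_ideal P \<longleftrightarrow> P = {0} \<or> maximal_ideal P" for P :: "'a set"
    using dim prime_ideal_zero maximal_ideal_imp_prime by blast
  have fin: "finite {M :: 'a set. maximal_ideal M}"
    by (rule NIP_prime_antichain_finite[OF NIP])
      (auto simp: maximal_ideal_imp_prime, auto simp: maximal_ideal_def)
  obtain x :: 'a where x: "x \<noteq> 0" "\<not> x dvd 1"
    using not_field by (auto simp: is_field_ring_def)
  then have "{r. x dvd r} \<noteq> UNIV"
    by auto
  then obtain M0 :: "'a set" where M0: "maximal_ideal M0"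
    using noetherian_maximal_ideal[OF noeth ring_ideal_multiples] by metis
  have "CHAR('a fract) = 0"
  proof (rule ccontr)
    assume char: "CHAR('a fract) \<noteq> 0"
    define p where "p = CHAR('a fract)"
    have p: "prime p" "of_nat p = (0 :: 'a fract)"
      using char prime_CHAR_semidom[where 'a = "'a fract"] by (auto simp: p_def)
    have "\<exists>a. a \<in> M \<and> a \<noteq> 0" if "maximal_ideal M" for M :: "'a set"
      using maximal_ideal_nonzero[OF not_field that] that ring_ideal_0[of M]
      by (auto simp: maximal_ideal_def)
    then obtain f where f: "\<And>M :: 'a set. maximal_ideal M \<Longrightarrow> f M \<in> M \<and> f M \<noteq> 0"
      by metis
    \<comment> \<open>Finiteness of the set of maximal ideals gives a nonzero element common to all
      of them, hence to all nonzero primes.\<close>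
    define t where "t = (\<Prod>M\<in>{M. maximal_ideal M}. f M)"
    have t0: "t \<noteq> 0"
      using f fin by (simp add: t_def)
    have t: "t \<in> M" if "maximal_ideal M" for M
      using f[OF that] that prime_ideal_prod[OF fin maximal_ideal_imp_prime[OF that], of f]
      by (auto simp: t_def)
    have unit: "\<not> t dvd 1"
    proof
      assume "t dvd 1"
      then obtain k where "1 = t * k"
        by (elim dvdE)
      moreover have "prime_ideal M0"
        using M0 by (rule maximal_ideal_imp_prime)
      ultimately show False
        using prime_idealD(3,4)[of M0] t[OF M0] by metis
    qed
    \<comment> \<open>The one-dimensional semilocal structure forbids a preimage of some
      \<open>u\<close> under the Artin--Schreier map, while NIP provides one for every
      \<open>u\<close>.\<close>
    obtain u :: "'a fract" where "\<forall>z. z ^ p - z \<noteq> u"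
      using noetherian_not_artin_schreier_closed[OF noeth t0 unit _ dim prime_ge_2_nat[OF p(1)]]
        t dim by blast
    moreover have "infinite (UNIV :: 'a set)"
      using finite_idom_is_field not_field by blast
    ultimately show False
      using NIP_fract_artin_schreier_closed[OF NIP _ p, of u] by blast
  qed
  moreover have "krull_dim TYPE('a) = 1"
    using krull_dim_eq_1[OF prime_iff M0 maximal_ideal_nonzero[OF not_field M0]] .
  ultimately show ?thesis
    using fin prime_iff by auto
qed

end
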